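(* Let $(E,e,T)$ be a conditional Riesz triple and let $x$ be a natural element in $E$. For each $n\in\mathbb N$ the following are equivalent: (i) $Tx^n\in E^u$ (i.e. $x\in L^n(T)$); (ii) $g_x^{(n)}(1)$ exists in $E^u$, in the sense that the left limit $\lim_{s\uparrow1}g_x^{(n)}(s)$ exists in $E^u$. In either case, $$g_x^{(n)}(1)=T\left[x(x-e)\cdots(x-(n-1)e)\right]=\sum_{k=n}^\infty k(k-1)\cdots(k-n+1)\,\pi_x(k).$$
   Context: A conditional Riesz triple $(E,e,T)$ consists of a Dedekind complete Riesz space $E$ with weak order unit $e$ and a conditional expectation operator $T$ on $E$, i.e. a positive order continuous projection with $Te=e$ whose range $R(T)$ is a Dedekind complete Riesz subspace; $T$ is also assumed strictly positive ($f>0\Rightarrow Tf>0$). $E^u$ is the universal completion of $E$, an $f$-algebra with multiplicative unit $e$ (products are taken there); $E^s$ is the sup-completion of $E$ (every non-empty subset of $E^s_+$ has a supremum; $E^u_+\subset E^s_+$). $T$ extends to $E^s_+$ by suprema of increasing nets. $P_z$ is the band projection onto the band generated by $z$, $P^d=I-P$, and $P_{x=y}=P^d_{|x-y|}$. The $T$-mass function of $x\in E$ is $\pi_x(t)=TP_{x=te}e$, $t\in\mathbb R$; $x$ is natural if $\sum_{n=0}^\infty \pi_x(n)=e$ (order sum). The $T$-generating function of a natural $x$ is $g_x:[0,\infty)\to E^s$, $g_x(s)=\sum_{n\ge0}s^n\pi_x(n)$. Derivatives are order derivatives: $f'(s_0)$ is the order limit of $(f(s)-f(s_0))/(s-s_0)$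 as $s\to s_0$, and $f^{(n+1)}=(f^{(n)})'$. On $[0,1)$, $g_x$ has order derivatives of all orders; limits are order limits. *)

theory Defs
  imports Complex_Main "HOL-Library.Lattice_Algebras"
begin

section \<open>Riesz spaces\<close>

class riesz_space = ordered_real_vector + lattice_ab_group_add_abs

class dedekind_complete_riesz_space = riesz_space + conditionally_complete_lattice

definition is_band :: "'a::dedekind_complete_riesz_space set \<Rightarrow> bool" where
  "is_band B \<longleftrightarrow> subspace B \<and> (\<forall>x y. y \<in> B \<and> \<bar>x\<bar> \<le> \<bar>y\<bar> \<longrightarrow> x \<in> B)
     \<and> (\<forall>D\<subseteq>B. D \<noteq> {} \<and> bdd_above D \<longrightarrow> Sup D \<in> B)"

definition band_gen :: "'a::dedekind_complete_riesz_space \<Rightarrow> 'a set" where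
  "band_gen z = is_band hull {z}"

definition disj_compl :: "'a::dedekind_complete_riesz_space set \<Rightarrow> 'a set" where
  "disj_compl B = {f. \<forall>b\<in>B. inf \<bar>f\<bar> \<bar>b\<bar> = 0}"

text \<open>By Dedekind completeness the space is the direct sum of a band and its disjoint complement, so
  the description below is well defined.\<close>

definition band_proj :: "'a::dedekind_complete_riesz_space \<Rightarrow> 'a \<Rightarrow> 'a" where
  "band_proj z f = (THE p. p \<in> band_gen z \<and> f - p \<in> disj_compl (band_gen z))"

definition eq_proj :: "'a::dedekind_complete_riesz_space \<Rightarrow> 'a \<Rightarrow> 'a \<Rightarrow> 'a" where
  "eq_proj x y f = f - band_proj \<bar>x - y\<bar> f"

definition weak_order_unit :: "'a::dedekind_complete_riesz_space \<Rightarrow> bool" where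
  "weak_order_unit e \<longleftrightarrow> 0 \<le> e \<and> band_gen e = UNIV"

section \<open>Order convergence and order derivatives\<close>

text \<open>A net \<open>f\<close> order converges to \<open>L\<close> if some net decreasing to \<open>0\<close> eventually dominates
  \<open>\<bar>f - L\<bar>\<close>. Only the range \<open>Y\<close> of the dominating net matters.\<close>

definition o_tendsto :: "('i \<Rightarrow> 'a::dedekind_complete_riesz_space) \<Rightarrow> 'a \<Rightarrow> 'i filter \<Rightarrow> bool" where
  "o_tendsto f L F \<longleftrightarrow>
     (\<exists>Y. Y \<noteq> {} \<and> (\<forall>a\<in>Y. \<forall>b\<in>Y. \<exists>c\<in>Y. c \<le> a \<and> c \<le> b) \<and> (\<forall>y\<in>Y. 0 \<le> y) \<and> Inf Y = 0
        \<and> (\<forall>y\<in>Y. eventually (\<lambda>i. \<bar>f i - L\<bar> \<le> y) F))"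

text \<open>Filters on the domain of \<open>T\<close> suffice: a net may be replaced by its image filter.\<close>

definition order_continuous ::
  "('a::dedekind_complete_riesz_space \<Rightarrow> 'b::dedekind_complete_riesz_space) \<Rightarrow> bool" where
  "order_continuous T \<longleftrightarrow> (\<forall>F L. o_tendsto (\<lambda>x. x) L F \<longrightarrow> o_tendsto T (T L) F)"

definition has_order_deriv ::
  "(real \<Rightarrow> 'a::dedekind_complete_riesz_space) \<Rightarrow> 'a \<Rightarrow> real \<Rightarrow> real set \<Rightarrow> bool" where
  "has_order_deriv f D s S \<longleftrightarrow> o_tendsto (\<lambda>t. (f t - f s) /\<^sub>R (t - s)) D (at s within S)"

definition order_deriv ::
  "real set \<Rightarrow> (real \<Rightarrow> 'a::dedekind_complete_riesz_space) \<Rightarrow> real \<Rightarrow> 'a" where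
  "order_deriv S f = (\<lambda>s. THE D. has_order_deriv f D s S)"

section \<open>Conditional Riesz triples\<close>

locale conditional_riesz_triple =
  fixes e :: "'a::dedekind_complete_riesz_space" and T :: "'a \<Rightarrow> 'a"
  assumes unit: "weak_order_unit e"
    and linear: "linear T"
    and positive: "0 \<le> f \<Longrightarrow> 0 \<le> T f"
    and order_cont: "order_continuous T"
    and projection: "T (T f) = T f"
    and T_unit: "T e = e"
    and range_sublattice: "f \<in> range T \<Longrightarrow> g \<in> range T \<Longrightarrow> sup f g \<in> range T \<and> inf f g \<in> range T"
    and range_dedekind_complete:
      "D \<subseteq> range T \<Longrightarrow> D \<noteq> {} \<Longrightarrow> \<exists>b\<in>range T. \<forall>d\<in>D. d \<le> b \<Longrightarrow>
         \<exists>m\<in>range T. (\<forall>d\<in>D. d \<le> m) \<and> (\<forall>b\<in>range T. (\<forall>d\<in>D. d \<le> b) \<longrightarrow> m \<le> b)"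
    and strictly_positive: "0 < f \<Longrightarrow> 0 < T f"

definition mass :: "'a::dedekind_complete_riesz_space \<Rightarrow> ('a \<Rightarrow> 'a) \<Rightarrow> 'a \<Rightarrow> real \<Rightarrow> 'a" where
  "mass e T x t = T (eq_proj x (t *\<^sub>R e) e)"

definition natural_element :: "'a::dedekind_complete_riesz_space \<Rightarrow> ('a \<Rightarrow> 'a) \<Rightarrow> 'a \<Rightarrow> bool" where
  "natural_element e T x \<longleftrightarrow> o_tendsto (\<lambda>N. \<Sum>k<N. mass e T x (real k)) e sequentially"

section \<open>Universal completion\<close>

text \<open>The universal completion is taken axiomatically, as a universally complete space together with
  an embedding of \<open>E\<close> as an order dense Riesz subspace; it is unique up to isomorphism. The
  \<open>f\<close>-algebra product on it is determined by its unit.\<close>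

class universally_complete_riesz_space = dedekind_complete_riesz_space +
  assumes laterally_complete:
    "(\<And>d. d \<in> D \<Longrightarrow> 0 \<le> d) \<Longrightarrow> (\<And>c d. c \<in> D \<Longrightarrow> d \<in> D \<Longrightarrow> c \<noteq> d \<Longrightarrow> inf c d = 0) \<Longrightarrow> bdd_above D"

class unital_f_algebra = riesz_space + real_algebra + monoid_mult +
  assumes f_algebra_mult_nonneg: "0 \<le> a \<Longrightarrow> 0 \<le> b \<Longrightarrow> 0 \<le> a * b"
    and f_algebra_disjoint: "inf a b = 0 \<Longrightarrow> 0 \<le> c \<Longrightarrow> inf (c * a) b = 0 \<and> inf (a * c) b = 0"

class universally_complete_f_algebra = universally_complete_riesz_space + unital_f_algebra

locale universal_completion =
  fixes \<iota> :: "'a::dedekind_complete_riesz_space \<Rightarrow> 'u::universally_complete_riesz_space"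
  assumes linear: "linear \<iota>"
    and inj: "inj \<iota>"
    and sup: "\<iota> (sup f g) = sup (\<iota> f) (\<iota> g)"
    and inf: "\<iota> (inf f g) = inf (\<iota> f) (\<iota> g)"
    and order_dense: "0 < u \<Longrightarrow> \<exists>f. 0 < \<iota> f \<and> \<iota> f \<le> u"

section \<open>Sup-completion\<close>

text \<open>The sup-completion of \<open>E\<close> is realised concretely: its element \<open>x\<close> is represented by the set
  \<open>{a \<in> E. a \<le> x}\<close>. It is a Dedekind complete ordered cone with a largest element in which \<open>E\<close> is
  the group of invertible elements and every element is the supremum of the elements of \<open>E\<close>
  below it. Scalar multiples are only needed, and hence only formed, in \<open>E\<close>.\<close>

definition sup_closed :: "'a::dedekind_complete_riesz_space set \<Rightarrow> bool" where
  "sup_closed A \<longleftrightarrow> A \<noteq> {} \<and> (\<forall>a\<in>A. \<forall>b. b \<le> a \<longrightarrow> b \<in> A)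
     \<and> (\<forall>D\<subseteq>A. D \<noteq> {} \<and> bdd_above D \<longrightarrow> Sup D \<in> A)"

lemma sup_closed_atMost: "sup_closed {..a}"
  by (auto simp: sup_closed_def intro: cSup_least)

typedef (overloaded) 'a sup_completion =
  "{A :: 'a::dedekind_complete_riesz_space set. sup_closed A}"
  using sup_closed_atMost by blast

definition sc_embed :: "'a::dedekind_complete_riesz_space \<Rightarrow> 'a sup_completion" where
  "sc_embed a = Abs_sup_completion {..a}"

lemma sup_closed_Rep [simp]: "sup_closed (Rep_sup_completion x)"
  using Rep_sup_completion by auto

lemma Rep_Abs [simp]: "sup_closed A \<Longrightarrow> Rep_sup_completion (Abs_sup_completion A) = A"
  by (simp add: Abs_sup_completion_inverse)

lemma Rep_sc_embed [simp]: "Rep_sup_completion (sc_embed a) = {..a}"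
  by (simp add: sc_embed_def sup_closed_atMost)

lemma sup_closed_lower: "sup_closed A \<Longrightarrow> a \<in> A \<Longrightarrow> b \<le> a \<Longrightarrow> b \<in> A"
  by (auto simp: sup_closed_def)

lemma sup_closed_Sup: "sup_closed A \<Longrightarrow> D \<subseteq> A \<Longrightarrow> D \<noteq> {} \<Longrightarrow> bdd_above D \<Longrightarrow> Sup D \<in> A"
  by (auto simp: sup_closed_def)

lemma sup_closed_Inter:
  assumes "\<And>A. A \<in> \<A> \<Longrightarrow> sup_closed A" "\<Inter>\<A> \<noteq> {}"
  shows "sup_closed (\<Inter>\<A>)"
  unfolding sup_closed_def
proof (intro conjI assms(2) ballI allI impI InterI)
  fix a b A assume "a \<in> \<Inter>\<A>" "b \<le> a" "A \<in> \<A>"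
  then show "b \<in> A" using sup_closed_lower[OF assms(1)] by blast
next
  fix D A assume "D \<subseteq> \<Inter>\<A>" "D \<noteq> {} \<and> bdd_above D" "A \<in> \<A>"
  then show "Sup D \<in> A" by (intro sup_closed_Sup[OF assms(1)]) auto
qed

lemma sup_closed_hull: "A \<noteq> {} \<Longrightarrow> sup_closed (sup_closed hull A)"
  unfolding hull_def by (rule sup_closed_Inter) auto

lemma sup_closed_inf:
  assumes "sup_closed A" "sup_closed B"
  shows "sup_closed (A \<inter> B)"
proof -
  obtain a b where "a \<in> A" "b \<in> B" using assms by (auto simp: sup_closed_def)
  then have "inf a b \<in> A \<inter> B"
    using sup_closed_lower[OF assms(1), of a "inf a b"] sup_closed_lower[OF assms(2), of b "inf a b"]
    by auto
  then show ?thesis using sup_closed_Inter[of "{A, B}"] assms by auto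
qed

instantiation sup_completion ::
  (dedekind_complete_riesz_space) "{lattice, order_top}"
begin

definition "x \<le> y \<longleftrightarrow> Rep_sup_completion x \<subseteq> Rep_sup_completion y"
definition "x < y \<longleftrightarrow> Rep_sup_completion x \<subset> Rep_sup_completion y"
definition "top = Abs_sup_completion UNIV"
definition "inf x y = Abs_sup_completion (Rep_sup_completion x \<inter> Rep_sup_completion y)"
definition "sup x y = Abs_sup_completion
  (sup_closed hull (Rep_sup_completion x \<union> Rep_sup_completion y))"

lemma Rep_ne: "Rep_sup_completion x \<noteq> {}"
  using sup_closed_Rep[of x] by (auto simp: sup_closed_def simp del: sup_closed_Rep)

lemma Rep_sup: "Rep_sup_completion (sup x y) =
    sup_closed hull (Rep_sup_completion x \<union> Rep_sup_completion y)"
  unfolding sup_sup_completion_def using Rep_ne by (subst Rep_Abs) (auto intro!: sup_closed_hull)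

lemma Rep_inf: "Rep_sup_completion (inf x y) = Rep_sup_completion x \<inter> Rep_sup_completion y"
  unfolding inf_sup_completion_def by (simp add: sup_closed_inf)

instance
proof
  fix x y z :: "'a sup_completion"
  show "x < y \<longleftrightarrow> x \<le> y \<and> \<not> y \<le> x" "x \<le> x" "x \<le> y \<Longrightarrow> y \<le> z \<Longrightarrow> x \<le> z"
    by (auto simp: less_eq_sup_completion_def less_sup_completion_def)
  show "x \<le> y \<Longrightarrow> y \<le> x \<Longrightarrow> x = y"
    by (auto simp: less_eq_sup_completion_def Rep_sup_completion_inject[symmetric])
  show "inf x y \<le> x" "inf x y \<le> y" "x \<le> y \<Longrightarrow> x \<le> z \<Longrightarrow> x \<le> inf y z"
    by (auto simp: less_eq_sup_completion_def Rep_inf)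
  show "x \<le> sup x y" "y \<le> sup x y"
    using hull_subset[of "Rep_sup_completion x \<union> Rep_sup_completion y" sup_closed]
    by (auto simp: less_eq_sup_completion_def Rep_sup)
  show "y \<le> x \<Longrightarrow> z \<le> x \<Longrightarrow> sup y z \<le> x"
    unfolding less_eq_sup_completion_def Rep_sup by (intro hull_minimal) simp_all
  show "x \<le> top"
    by (simp add: less_eq_sup_completion_def top_sup_completion_def sup_closed_def)
qed

end

instantiation sup_completion :: (dedekind_complete_riesz_space) conditionally_complete_lattice
begin

definition "Inf X = Abs_sup_completion (\<Inter>x\<in>X. Rep_sup_completion x)"
definition "Sup X = Abs_sup_completion (sup_closed hull (\<Union>x\<in>X. Rep_sup_completion x))"

lemma Rep_Sup: "X \<noteq> {} \<Longrightarrow>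
    Rep_sup_completion (Sup X) = sup_closed hull (\<Union>x\<in>X. Rep_sup_completion x)"
  unfolding Sup_sup_completion_def using Rep_ne by (subst Rep_Abs) (auto intro!: sup_closed_hull)

instance
proof
  fix x z :: "'a sup_completion" and X :: "'a sup_completion set"
  show "Inf X \<le> x" if X: "x \<in> X" "bdd_below X"
  proof -
    obtain m where "\<And>x. x \<in> X \<Longrightarrow> m \<le> x" using X(2) by (auto simp: bdd_below_def)
    then have "(\<Inter>x\<in>X. Rep_sup_completion x) \<noteq> {}"
      using Rep_ne[of m] unfolding less_eq_sup_completion_def by blast
    then have "sup_closed (\<Inter>x\<in>X. Rep_sup_completion x)" by (intro sup_closed_Inter) auto
    then show ?thesis using X(1) by (auto simp: less_eq_sup_completion_def Inf_sup_completion_def)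
  qed
  show "z \<le> Inf X" if "X \<noteq> {}" "\<And>x. x \<in> X \<Longrightarrow> z \<le> x"
  proof -
    have sub: "Rep_sup_completion z \<subseteq> (\<Inter>x\<in>X. Rep_sup_completion x)"
      using that(2) unfolding less_eq_sup_completion_def by blast
    then have "(\<Inter>x\<in>X. Rep_sup_completion x) \<noteq> {}" using Rep_ne[of z] by blast
    then have "sup_closed (\<Inter>x\<in>X. Rep_sup_completion x)" by (intro sup_closed_Inter) auto
    then show ?thesis using sub by (auto simp: less_eq_sup_completion_def Inf_sup_completion_def)
  qed
  show "x \<le> Sup X" if "x \<in> X" "bdd_above X"
  proof -
    have "X \<noteq> {}" using that(1) by auto
    moreover have "Rep_sup_completion x \<subseteq> (\<Union>x\<in>X. Rep_sup_completion x)" using that(1) by auto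
    ultimately show ?thesis
      using hull_subset[of "\<Union>x\<in>X. Rep_sup_completion x" sup_closed]
      by (simp add: less_eq_sup_completion_def Rep_Sup)
  qed
  show "Sup X \<le> z" if "X \<noteq> {}" "\<And>x. x \<in> X \<Longrightarrow> x \<le> z"
    using that unfolding less_eq_sup_completion_def Rep_Sup[OF that(1)]
    by (intro hull_minimal) auto
qed

end

lemma sc_embed_le_iff_mem: "sc_embed a \<le> x \<longleftrightarrow> a \<in> Rep_sup_completion x"
  by (auto simp: less_eq_sup_completion_def intro: sup_closed_lower[OF sup_closed_Rep])

lemma sc_embed_le_iff [simp]: "sc_embed a \<le> sc_embed b \<longleftrightarrow> a \<le> b"
  by (simp add: sc_embed_le_iff_mem)

lemma sup_completion_bdd_above [simp]: "bdd_above (X :: 'a::dedekind_complete_riesz_space sup_completion set)"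
  by (auto intro: bdd_aboveI[of _ top])

lemma sc_embed_lower_nonempty: "\<exists>a. sc_embed a \<le> x"
  using Rep_ne[of x] by (auto simp: sc_embed_le_iff_mem)

lemma sup_completion_eq_Sup: "x = Sup (sc_embed ` {a. sc_embed a \<le> x})"
proof (rule order.antisym)
  show "x \<le> Sup (sc_embed ` {a. sc_embed a \<le> x})"
  proof (rule less_eq_sup_completion_def[THEN iffD2], rule subsetI)
    fix a assume "a \<in> Rep_sup_completion x"
    then have "sc_embed a \<in> sc_embed ` {a. sc_embed a \<le> x}" by (simp add: sc_embed_le_iff_mem)
    then show "a \<in> Rep_sup_completion (Sup (sc_embed ` {a. sc_embed a \<le> x}))"
      by (intro iffD1[OF sc_embed_le_iff_mem] cSup_upper) auto
  qed
  show "Sup (sc_embed ` {a. sc_embed a \<le> x}) \<le> x"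
    using sc_embed_lower_nonempty[of x] by (intro cSup_least) auto
qed

lemma sc_embed_Sup:
  fixes D :: "'a::dedekind_complete_riesz_space set"
  assumes "D \<noteq> {}" "bdd_above D"
  shows "sc_embed (Sup D) = Sup (sc_embed ` D)"
proof (rule order.antisym)
  have "D \<subseteq> Rep_sup_completion (Sup (sc_embed ` D))"
    by (auto simp flip: sc_embed_le_iff_mem intro!: cSup_upper[OF imageI])
  then show "sc_embed (Sup D) \<le> Sup (sc_embed ` D)"
    using assms by (auto simp: sc_embed_le_iff_mem intro: sup_closed_Sup)
  show "Sup (sc_embed ` D) \<le> sc_embed (Sup D)"
    using assms by (intro cSup_least) (auto intro: cSup_upper)
qed

lemma sc_embed_inf: "sc_embed (inf a b) = inf (sc_embed a) (sc_embed b)"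
  by (auto simp: Rep_sup_completion_inject[symmetric] Rep_inf)

lemma sup_closed_translate:
  assumes "sup_closed A"
  shows "sup_closed {a. a + c \<in> A}"
  unfolding sup_closed_def
proof (intro conjI ballI allI impI)
  obtain a where "a \<in> A" using assms by (auto simp: sup_closed_def)
  then have "(a - c) + c \<in> A" by simp
  then show "{a. a + c \<in> A} \<noteq> {}" by blast
  show "b \<in> {a. a + c \<in> A}" if "a \<in> {a. a + c \<in> A}" "b \<le> a" for a b
    using that sup_closed_lower[OF assms, of "a + c" "b + c"] by auto
  show "Sup D \<in> {a. a + c \<in> A}" if D: "D \<subseteq> {a. a + c \<in> A}" "D \<noteq> {} \<and> bdd_above D" for D
  proof -
    have ne: "(\<lambda>d. d + c) ` D \<noteq> {}" using D by auto
    obtain m where "\<And>d. d \<in> D \<Longrightarrow> d \<le> m" using D by (auto simp: bdd_above_def)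
    then have bdd: "bdd_above ((\<lambda>d. d + c) ` D)" by (intro bdd_aboveI[of _ "m + c"]) auto
    have "d \<le> Sup ((\<lambda>d. d + c) ` D) - c" if "d \<in> D" for d
      using cSup_upper[OF imageI[OF that, of "\<lambda>d. d + c"] bdd] by (simp add: le_diff_eq)
    then have "Sup D \<le> Sup ((\<lambda>d. d + c) ` D) - c" using D by (intro cSup_least) auto
    then have "Sup D + c \<le> Sup ((\<lambda>d. d + c) ` D)" by (simp add: le_diff_eq)
    moreover have "Sup ((\<lambda>d. d + c) ` D) \<in> A" using D ne bdd by (intro sup_closed_Sup[OF assms]) auto
    ultimately show ?thesis using sup_closed_lower[OF assms] by auto
  qed
qed

definition set_sum :: "'a::plus set \<Rightarrow> 'a set \<Rightarrow> 'a set" where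
  "set_sum A B = {a + b | a b. a \<in> A \<and> b \<in> B}"

lemma set_sum_subset:
  fixes A B C :: "'a::dedekind_complete_riesz_space set"
  assumes "set_sum A B \<subseteq> C" "sup_closed C"
  shows "set_sum (sup_closed hull A) B \<subseteq> C"
proof -
  have "sup_closed hull A \<subseteq> {a. a + b \<in> C}" if "b \<in> B" for b
    using assms that by (intro hull_minimal sup_closed_translate) (auto simp: set_sum_def)
  then show ?thesis by (auto simp: set_sum_def)
qed

lemma set_sum_commute: "set_sum A B = set_sum B (A :: 'a::ab_semigroup_add set)"
  unfolding set_sum_def by (subst add.commute) blast

lemma set_sum_assoc: "set_sum (set_sum A B) C = set_sum A (set_sum B (C :: 'a::ab_semigroup_add set))"
  proof
  show "set_sum (set_sum A B) C \<subseteq> set_sum A (set_sum B C)"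
    unfolding set_sum_def by (clarsimp simp: add.assoc) blast
  show "set_sum A (set_sum B C) \<subseteq> set_sum (set_sum A B) C"
    unfolding set_sum_def by (clarsimp simp flip: add.assoc) blast
qed

lemma hull_set_sum:
  fixes A B :: "'a::dedekind_complete_riesz_space set"
  assumes "A \<noteq> {}" "B \<noteq> {}"
  shows "sup_closed hull (set_sum (sup_closed hull A) B) = sup_closed hull (set_sum A B)"
proof
  have "sup_closed (sup_closed hull (set_sum A B))"
    using assms by (intro sup_closed_hull) (auto simp: set_sum_def)
  then show "sup_closed hull (set_sum (sup_closed hull A) B) \<subseteq> sup_closed hull (set_sum A B)"
    by (intro hull_minimal set_sum_subset hull_subset)
  show "sup_closed hull (set_sum A B) \<subseteq> sup_closed hull (set_sum (sup_closed hull A) B)"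
    by (intro hull_mono) (auto simp: set_sum_def dest: hull_inc)
qed

instantiation sup_completion :: (dedekind_complete_riesz_space) ordered_comm_monoid_add
begin

definition "0 = sc_embed 0"
definition "x + y = Abs_sup_completion
  (sup_closed hull (set_sum (Rep_sup_completion x) (Rep_sup_completion y)))"

lemma Rep_plus: "Rep_sup_completion (x + y) =
    sup_closed hull (set_sum (Rep_sup_completion x) (Rep_sup_completion y))"
proof -
  have "set_sum (Rep_sup_completion x) (Rep_sup_completion y) \<noteq> {}"
    using Rep_ne[of x] Rep_ne[of y] by (auto simp: set_sum_def)
  then show ?thesis by (simp add: plus_sup_completion_def sup_closed_hull)
qed

instance
proof
  fix x y z :: "'a sup_completion"
  show comm: "x + y = y + x" for x y :: "'a sup_completion"
    by (simp add: plus_sup_completion_def set_sum_commute)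
  have ne: "set_sum (Rep_sup_completion x) (Rep_sup_completion y) \<noteq> {}" for x y :: "'a sup_completion"
    using Rep_ne[of x] Rep_ne[of y] by (auto simp: set_sum_def)
  have *: "Rep_sup_completion (x + y + z) = sup_closed hull
      (set_sum (set_sum (Rep_sup_completion x) (Rep_sup_completion y)) (Rep_sup_completion z))"
    for x y z :: "'a sup_completion"
    unfolding Rep_plus by (rule hull_set_sum[OF ne Rep_ne])
  have "x + y + z = y + z + x"
    unfolding Rep_sup_completion_inject[symmetric] *
    by (subst set_sum_assoc, subst set_sum_commute) simp
  then show "x + y + z = x + (y + z)" by (simp only: comm)
  have "set_sum {..0} (Rep_sup_completion x) = Rep_sup_completion x"
  proof
    have "a + b \<in> Rep_sup_completion x" if "a \<le> 0" "b \<in> Rep_sup_completion x" for a b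
      using sup_closed_lower[OF sup_closed_Rep that(2), of "a + b"] add_right_mono[OF that(1), of b]
      by simp
    then show "set_sum {..0} (Rep_sup_completion x) \<subseteq> Rep_sup_completion x"
      by (auto simp: set_sum_def)
    show "Rep_sup_completion x \<subseteq> set_sum {..0} (Rep_sup_completion x)"
    proof
      fix a assume "a \<in> Rep_sup_completion x"
      moreover have "a = 0 + a" by simp
      ultimately show "a \<in> set_sum {..0} (Rep_sup_completion x)"
        unfolding set_sum_def by blast
    qed
  qed
  then show "0 + x = x"
    by (simp add: Rep_sup_completion_inject[symmetric] Rep_plus zero_sup_completion_def hull_same)
  show "z + x \<le> z + y" if "x \<le> y"
    using that unfolding less_eq_sup_completion_def Rep_plus
    by (intro hull_mono) (auto simp: set_sum_def)
qed

end

lemma sc_embed_zero: "sc_embed 0 = 0"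
  by (simp add: zero_sup_completion_def)

lemma sc_embed_add: "sc_embed (a + b) = sc_embed a + sc_embed b"
proof -
  have "set_sum {..a} {..b} = {..a + b}"
  proof
    show "set_sum {..a} {..b} \<subseteq> {..a + b}" by (auto simp: set_sum_def intro: add_mono)
    show "{..a + b} \<subseteq> set_sum {..a} {..b}"
    proof
      fix c assume "c \<in> {..a + b}"
      then have "c = (c - b) + b" "c - b \<le> a" by (auto simp: diff_le_eq)
      then show "c \<in> set_sum {..a} {..b}" unfolding set_sum_def by blast
    qed
  qed
  then show ?thesis
    by (simp add: Rep_sup_completion_inject[symmetric] Rep_plus hull_same sup_closed_atMost)
qed

lemma sup_completion_invertible_iff: "(\<exists>y. x + y = 0) \<longleftrightarrow> x \<in> range sc_embed"
proof
  assume "\<exists>y. x + y = 0"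
  then obtain y where y: "x + y = 0" ..
  obtain b where b: "b \<in> Rep_sup_completion y" using Rep_ne by blast
  have "a \<le> - b" if "a \<in> Rep_sup_completion x" for a
  proof -
    have "a + b \<in> Rep_sup_completion (x + y)"
      unfolding Rep_plus using that b by (intro hull_inc) (auto simp: set_sum_def)
    then have "a + b \<le> 0" by (simp add: y zero_sup_completion_def)
    then have "a + b + (- b) \<le> 0 + (- b)" by (rule add_right_mono)
    then show ?thesis by simp
  qed
  then have bdd: "bdd_above (Rep_sup_completion x)" by (intro bdd_aboveI)
  then have "Sup (Rep_sup_completion x) \<in> Rep_sup_completion x"
    by (intro sup_closed_Sup) (auto simp: Rep_ne)
  then have "Rep_sup_completion x = {..Sup (Rep_sup_completion x)}"
    using bdd by (auto intro: cSup_upper sup_closed_lower[OF sup_closed_Rep])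
  then have "x = sc_embed (Sup (Rep_sup_completion x))"
    by (simp add: Rep_sup_completion_inject[symmetric])
  then show "x \<in> range sc_embed" by blast
next
  assume "x \<in> range sc_embed"
  then obtain a where "x = sc_embed a" by blast
  then have "x + sc_embed (- a) = 0" by (simp add: sc_embed_zero flip: sc_embed_add)
  then show "\<exists>y. x + y = 0" ..
qed

section \<open>Generating functions\<close>

text \<open>The canonical inclusion of the positive cone of the universal completion into the
  sup-completion.\<close>

definition u_to_s ::
  "('a::dedekind_complete_riesz_space \<Rightarrow> 'u::universally_complete_riesz_space) \<Rightarrow> 'u \<Rightarrow> 'a sup_completion" where
  "u_to_s \<iota> u = Sup (sc_embed ` {a. 0 \<le> a \<and> \<iota> a \<le> u})"

text \<open>For \<open>x \<ge> 0\<close> the set \<open>{a. 0 \<le> a \<and> a \<le> x}\<close> is directed upwards with supremum \<open>x\<close>.\<close>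

definition T_sup :: "('a::dedekind_complete_riesz_space \<Rightarrow> 'a) \<Rightarrow> 'a sup_completion \<Rightarrow> 'a sup_completion" where
  "T_sup T x = Sup ((\<lambda>a. sc_embed (T a)) ` {a. 0 \<le> a \<and> sc_embed a \<le> x})"

text \<open>The series \<open>\<Sum>k=m..\<infinity>. f k\<close> of positive terms in the sup-completion.\<close>

definition s_series ::
  "nat \<Rightarrow> (nat \<Rightarrow> 'a::dedekind_complete_riesz_space sup_completion) \<Rightarrow> 'a sup_completion" where
  "s_series m f = (SUP N. \<Sum>k=m..<N. f k)"

definition gen_fun ::
  "'a::dedekind_complete_riesz_space \<Rightarrow> ('a \<Rightarrow> 'a) \<Rightarrow> 'a \<Rightarrow> real \<Rightarrow> 'a sup_completion" where
  "gen_fun e T x s = s_series 0 (\<lambda>k. sc_embed (s ^ k *\<^sub>R mass e T x (real k)))"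

text \<open>On \<open>[0,1)\<close> the generating function is bounded by the unit; differences and order limits are
  formed after reading its values in the universal completion.\<close>

definition gen_fun_u ::
  "('a::dedekind_complete_riesz_space \<Rightarrow> 'u::universally_complete_riesz_space) \<Rightarrow>
    'a \<Rightarrow> ('a \<Rightarrow> 'a) \<Rightarrow> 'a \<Rightarrow> real \<Rightarrow> 'u" where
  "gen_fun_u \<iota> e T x s = inv_into {0..} (u_to_s \<iota>) (gen_fun e T x s)"

definition gen_fun_deriv ::
  "('a::dedekind_complete_riesz_space \<Rightarrow> 'u::universally_complete_riesz_space) \<Rightarrow>
    'a \<Rightarrow> ('a \<Rightarrow> 'a) \<Rightarrow> 'a \<Rightarrow> nat \<Rightarrow> real \<Rightarrow> 'u" where
  "gen_fun_deriv \<iota> e T x n = (order_deriv {0..<1} ^^ n) (gen_fun_u \<iota> e T x)"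

definition falling :: "real \<Rightarrow> nat \<Rightarrow> real" where
  "falling t n = (\<Prod>i<n. t - real i)"

definition falling_elem ::
  "('a::dedekind_complete_riesz_space \<Rightarrow> 'u::universally_complete_f_algebra) \<Rightarrow> 'a \<Rightarrow> 'a \<Rightarrow> nat \<Rightarrow> 'u" where
  "falling_elem \<iota> e x n = prod_list (map (\<lambda>i. \<iota> (x - real i *\<^sub>R e)) [0..<n])"

end

theory Submission
  imports Defs
begin

text \<open>Why the equivalence holds. Write \<open>X\<close> for the image of \<open>x\<close> in the universal completion and let
  \<open>p k\<close> be the component of \<open>e\<close> on which \<open>x\<close> equals \<open>k e\<close> (\<open>level k\<close> below), so that the mass at \<open>k\<close> is
  \<open>T (p k)\<close>. The \<open>p k\<close> are pairwise disjoint, and strict positivity of \<open>T\<close> turns naturality, which is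
  a statement about \<open>T (p k)\<close>, into the statement that the \<open>p k\<close> exhaust \<open>e\<close>
  (\<open>e_le_if_sum_level_le\<close>). Hence their images form a countable partition of the unit of the
  \<open>f\<close>-algebra, with \<open>X P k = k P k\<close>, and every polynomial \<open>f (X)\<close> with \<open>f (k) \<ge> 0\<close> for all \<open>k\<close> is
  the increasing supremum of the sums \<open>\<Sum>k<N. f (k) P k\<close>. Order continuity of \<open>T\<close> gives
  \<open>T f (X) = \<Sum>k. f (k) \<pi> k\<close> in the sup-completion (\<open>T_sup_spectral_series\<close>).

  Such a series lies in the universal completion exactly if its partial sums are bounded there
  (\<open>Sup_mem_u_to_s_iff\<close>). As \<open>k ^ n\<close> and the falling factorial \<open>k (k - 1) \<cdots> (k - n + 1)\<close>
  dominate each other up to a factor and finitely many \<open>k\<close>, condition (i) says that the \<open>n\<close>-th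
  factorial moment series is bounded.

  On the analytic side the masses lie between \<open>0\<close> and the unit, so a real power series that converges
  absolutely may be multiplied termwise by the masses, and every real estimate on the remainder becomes
  an estimate relative to the unit. In this way the derivatives of the generating function on
  \<open>[0,1)\<close> are found termwise (\<open>has_order_deriv_power_series\<close>). The \<open>n\<close>-th derivative increases with
  \<open>s\<close> and its supremum over \<open>s < 1\<close> is the factorial moment series, so the left limit at \<open>1\<close> exists
  exactly if that series is bounded, and then is its sum
  (\<open>bdd_above_if_left_limit\<close>, \<open>left_limit_if_bdd_above\<close>).\<close>

section \<open>Riesz spaces\<close>

text \<open>The supremum of the bounded set of multiples of \<open>a\<close> is also bounded by itself minus \<open>a\<close>.\<close>

lemma archimedean:
  fixes a b :: "'a::dedekind_complete_riesz_space"
  assumes "\<And>n::nat. real n *\<^sub>R a \<le> b"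
  shows "a \<le> 0"
proof -
  let ?D = "range (\<lambda>n::nat. real n *\<^sub>R a)"
  have bdd: "bdd_above ?D" using assms by (intro bdd_aboveI[of _ b]) auto
  have "real n *\<^sub>R a \<le> Sup ?D - a" for n
  proof -
    have "real (Suc n) *\<^sub>R a \<le> Sup ?D" using bdd by (rule cSup_upper[OF rangeI])
    then show ?thesis by (simp add: algebra_simps)
  qed
  then have "Sup ?D \<le> Sup ?D - a" by (intro cSup_least) auto
  then show ?thesis by simp
qed

lemma le_scaleR_limit:
  fixes a u :: "'a::dedekind_complete_riesz_space"
  assumes le: "\<And>n::nat. a \<le> r n *\<^sub>R u" and lim: "r \<longlonglongrightarrow> l" and u: "0 \<le> u"
  shows "a \<le> l *\<^sub>R u"
proof -
  have "real m *\<^sub>R (a - l *\<^sub>R u) \<le> u" for m :: nat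
  proof -
    have "eventually (\<lambda>n. r n < l + 1 / (real m + 1)) sequentially"
      using lim by (intro order_tendstoD) auto
    then obtain n where n: "r n < l + 1 / (real m + 1)"
      by (auto simp: eventually_sequentially)
    have "real m * (r n - l) \<le> real m * (1 / (real m + 1))"
      using n by (intro mult_left_mono) auto
    also have "\<dots> \<le> 1" by (simp add: field_simps)
    finally have *: "real m * (r n - l) \<le> 1" .
    have "real m *\<^sub>R (a - l *\<^sub>R u) \<le> real m *\<^sub>R (r n *\<^sub>R u - l *\<^sub>R u)"
      using le[of n] by (intro scaleR_left_mono) auto
    also have "\<dots> = (real m * (r n - l)) *\<^sub>R u" by (simp add: algebra_simps)
    also have "\<dots> \<le> 1 *\<^sub>R u" using * u by (rule scaleR_right_mono)
    finally show ?thesis by simp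
  qed
  then have "a - l *\<^sub>R u \<le> 0" by (rule archimedean)
  then show ?thesis by simp
qed

lemma inf_add_le:
  fixes a b c :: "'a::riesz_space"
  assumes "0 \<le> a" "0 \<le> b" "0 \<le> c"
  shows "inf (a + b) c \<le> inf a c + inf b c"
proof -
  let ?w = "inf (a + b) c"
  have w: "?w \<le> a + b" "?w \<le> c" by auto
  have "?w - inf b c \<le> a" 
  proof -
    have "?w - a \<le> b" using w(1) by (simp add: algebra_simps)
    moreover have "?w - a \<le> c" using add_mono[OF w(2) assms(1)] by (simp add: diff_le_eq)
    ultimately have "?w - a \<le> inf b c" by simp
    then show ?thesis by (simp only: diff_le_eq add.commute)
  qed
  moreover have "?w - inf b c \<le> c"
  proof -
    have "?w - inf b c \<le> ?w - 0" using assms by (intro diff_left_mono) simp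
    then show ?thesis using w(2) by simp
  qed
  ultimately have "?w - inf b c \<le> inf a c" by (rule le_infI)
  then show ?thesis by (simp only: diff_le_eq)
qed

lemma disjoint_mono:
  fixes a b c :: "'a::riesz_space"
  assumes "inf a c = 0" "0 \<le> b" "b \<le> a"
  shows "inf b c = 0"
proof (rule order.antisym)
  show "inf b c \<le> 0" using inf_mono[OF assms(3) order.refl, of c] assms(1) by simp
  show "0 \<le> inf b c" using assms by (metis inf.cobounded2 le_inf_iff)
qed

lemma disjoint_add:
  fixes a b c :: "'a::riesz_space"
  assumes "inf a c = 0" "inf b c = 0"
  shows "inf (a + b) c = 0"
proof (rule order.antisym)
  have nn: "0 \<le> a" "0 \<le> b" "0 \<le> c" using assms by (metis inf.cobounded1 inf.cobounded2)+
  show "inf (a + b) c \<le> 0" using inf_add_le[OF nn] assms by simp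
  show "0 \<le> inf (a + b) c" using nn by simp
qed

lemma disjoint_sum:
  fixes f :: "'i \<Rightarrow> 'a::riesz_space"
  assumes "finite I" "\<And>i. i \<in> I \<Longrightarrow> inf (f i) c = 0" "0 \<le> c"
  shows "inf (sum f I) c = 0"
  using assms by (induction I) (auto intro: disjoint_add simp: inf_absorb1)

lemma disjoint_add_eq_sup:
  fixes a b :: "'a::riesz_space"
  assumes "inf a b = 0"
  shows "a + b = sup a b"
  using add_eq_inf_sup[of a b] assms by simp

lemma sum_disjoint_le:
  fixes f :: "'i \<Rightarrow> 'a::riesz_space"
  assumes "finite I" "\<And>i j. i \<in> I \<Longrightarrow> j \<in> I \<Longrightarrow> i \<noteq> j \<Longrightarrow> inf (f i) (f j) = 0"
    and "\<And>i. i \<in> I \<Longrightarrow> 0 \<le> f i \<and> f i \<le> e" "0 \<le> e"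
  shows "sum f I \<le> e"
  using assms
proof (induction I)
  case (insert i I)
  have "inf (sum f I) (f i) = 0" using insert by (intro disjoint_sum) auto
  then have "f i + sum f I = sup (f i) (sum f I)" by (intro disjoint_add_eq_sup) (simp add: inf.commute)
  then show ?case using insert by auto
qed auto

lemma abs_scaleR:
  fixes a :: "'a::riesz_space"
  shows "\<bar>r *\<^sub>R a\<bar> = \<bar>r\<bar> *\<^sub>R \<bar>a\<bar>"
proof -
  have *: "\<bar>r *\<^sub>R a\<bar> \<le> \<bar>r\<bar> *\<^sub>R \<bar>a\<bar>" for r and a :: 'a
  proof (cases "0 \<le> r")
    case True
    then show ?thesis
      using scaleR_left_mono[OF abs_ge_self[of a] True] scaleR_left_mono[OF abs_ge_minus_self[of a] True]
      by (intro abs_leI) auto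
  next
    case False
    then have "0 \<le> - r" by simp
    then show ?thesis
      using scaleR_left_mono[OF abs_ge_self[of a], of "- r"] scaleR_left_mono[OF abs_ge_minus_self[of a], of "- r"] False
      by (intro abs_leI) auto
  qed
  show ?thesis
  proof (cases "r = 0")
    case False
    have "\<bar>r\<bar> *\<^sub>R \<bar>a\<bar> = \<bar>r\<bar> *\<^sub>R \<bar>inverse r *\<^sub>R (r *\<^sub>R a)\<bar>" using False by simp
    also have "\<dots> \<le> \<bar>r\<bar> *\<^sub>R (\<bar>inverse r\<bar> *\<^sub>R \<bar>r *\<^sub>R a\<bar>)" by (intro scaleR_left_mono *) simp
    also have "\<dots> = \<bar>r *\<^sub>R a\<bar>" using False by (simp flip: abs_mult)
    finally show ?thesis using * by (intro order.antisym)
  qed simp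
qed

section \<open>Order limits\<close>

lemma o_tendsto_unique:
  assumes "o_tendsto f L F" "o_tendsto f M F" "F \<noteq> bot"
  shows "L = M"
proof -
  obtain Y where Y: "Y \<noteq> {}" "\<forall>y\<in>Y. 0 \<le> y" "Inf Y = 0" "\<forall>y\<in>Y. eventually (\<lambda>i. \<bar>f i - L\<bar> \<le> y) F"
    using assms(1) unfolding o_tendsto_def by blast
  obtain Z where Z: "Z \<noteq> {}" "\<forall>y\<in>Z. 0 \<le> y" "Inf Z = 0" "\<forall>y\<in>Z. eventually (\<lambda>i. \<bar>f i - M\<bar> \<le> y) F"
    using assms(2) unfolding o_tendsto_def by blast
  have *: "\<bar>L - M\<bar> \<le> y + z" if "y \<in> Y" "z \<in> Z" for y z
  proof -
    have "eventually (\<lambda>i. \<bar>f i - L\<bar> \<le> y \<and> \<bar>f i - M\<bar> \<le> z) F"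
      using bspec[OF Y(4) that(1)] bspec[OF Z(4) that(2)] by (rule eventually_conj)
    then obtain i where i: "\<bar>f i - L\<bar> \<le> y" "\<bar>f i - M\<bar> \<le> z"
      using eventually_happens'[OF assms(3)] by blast
    have "\<bar>L - M\<bar> \<le> \<bar>f i - M\<bar> + \<bar>f i - L\<bar>"
      using abs_triangle_ineq4[of "f i - M" "f i - L"] by simp
    also have "\<dots> \<le> z + y" using i by (intro add_mono)
    finally show ?thesis by (simp add: add.commute)
  qed
  have "\<bar>L - M\<bar> \<le> z" if "z \<in> Z" for z
  proof -
    have "\<bar>L - M\<bar> - z \<le> Inf Y" using *[OF _ that] Y by (intro cInf_greatest) (auto simp: algebra_simps)
    then show ?thesis using Y by simp
  qed
  then have "\<bar>L - M\<bar> \<le> Inf Z" using Z by (intro cInf_greatest)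
  then show ?thesis using Z by simp
qed

lemma o_tendsto_uniform:
  fixes u :: "'a::dedekind_complete_riesz_space"
  assumes "eventually (\<lambda>i. \<bar>f i - L\<bar> \<le> r i *\<^sub>R u) F" "(r \<longlongrightarrow> 0) F" "0 \<le> u"
  shows "o_tendsto f L F"
  unfolding o_tendsto_def
proof (intro exI[of _ "(\<lambda>\<delta>. \<delta> *\<^sub>R u) ` {0<..}"] conjI ballI)
  let ?Y = "(\<lambda>\<delta>. \<delta> *\<^sub>R u) ` {0<..}"
  show "?Y \<noteq> {}" by simp
  show "\<exists>c\<in>?Y. c \<le> a \<and> c \<le> b" if "a \<in> ?Y" "b \<in> ?Y" for a b
  proof -
    from that(1) obtain \<delta> where "a = \<delta> *\<^sub>R u" "\<delta> \<in> {0<..}" by (rule imageE)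
    moreover from that(2) obtain \<eta> where "b = \<eta> *\<^sub>R u" "\<eta> \<in> {0<..}" by (rule imageE)
    ultimately show ?thesis using assms(3)
      by (intro bexI[of _ "min \<delta> \<eta> *\<^sub>R u"]) (auto intro: scaleR_right_mono)
  qed
  show "0 \<le> y" if "y \<in> ?Y" for y using that assms(3) by (auto intro: scaleR_nonneg_nonneg)
  then have bdd: "bdd_below ?Y" by (intro bdd_belowI[of _ 0]) auto
  show "Inf ?Y = 0"
  proof (rule order.antisym)
    show "0 \<le> Inf ?Y" using assms(3) by (intro cInf_greatest) (auto intro: scaleR_nonneg_nonneg)
    have "Inf ?Y \<le> 0 *\<^sub>R u"
    proof (rule le_scaleR_limit[where r = "\<lambda>n. inverse (real (Suc n))"])
      show "Inf ?Y \<le> inverse (real (Suc n)) *\<^sub>R u" for n using bdd by (intro cInf_lower) auto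
    qed (use assms(3) LIMSEQ_inverse_real_of_nat in auto)
    then show "Inf ?Y \<le> 0" by simp
  qed
  fix y assume "y \<in> ?Y"
  then obtain \<delta> where d: "y = \<delta> *\<^sub>R u" "\<delta> > 0" by auto
  have "eventually (\<lambda>i. r i < \<delta>) F" using assms(2) d(2) by (intro order_tendstoD)
  with assms(1) show "eventually (\<lambda>i. \<bar>f i - L\<bar> \<le> y) F"
  proof eventually_elim
    case (elim i)
    have "r i *\<^sub>R u \<le> \<delta> *\<^sub>R u" using elim assms(3) by (intro scaleR_right_mono) auto
    then show ?case using elim d by (meson order_trans)
  qed
qed

lemma o_tendsto_cong:
  assumes "eventually (\<lambda>i. f i = g i) F"
  shows "o_tendsto f L F \<longleftrightarrow> o_tendsto g L F"
proof -
  have "eventually (\<lambda>i. \<bar>f i - L\<bar> \<le> y) F \<longleftrightarrow> eventually (\<lambda>i. \<bar>g i - L\<bar> \<le> y) F" for y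
    by (rule eventually_cong[OF assms]) simp
  then show ?thesis unfolding o_tendsto_def by simp
qed

section \<open>Band projections\<close>

lemma is_band_band_gen: "is_band (band_gen z)"
proof -
  have "is_band (\<Inter>\<B>)" if \<B>: "\<And>B. B \<in> \<B> \<Longrightarrow> is_band B" for \<B> :: "'a set set"
    unfolding is_band_def
  proof (intro conjI allI impI)
    show "subspace (\<Inter>\<B>)" using \<B> by (auto intro!: subspace_Inter simp: is_band_def)
    show "x \<in> \<Inter>\<B>" if "y \<in> \<Inter>\<B> \<and> \<bar>x\<bar> \<le> \<bar>y\<bar>" for x y
      using that \<B> unfolding is_band_def by blast
    show "Sup D \<in> \<Inter>\<B>" if D: "D \<subseteq> \<Inter>\<B>" "D \<noteq> {} \<and> bdd_above D" for D
    proof (rule InterI)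
      fix B assume "B \<in> \<B>"
      then have "D \<subseteq> B" using D(1) by blast
      then show "Sup D \<in> B" using \<B>[OF \<open>B \<in> \<B>\<close>] D(2) unfolding is_band_def by blast
    qed
  qed
  then show ?thesis unfolding band_gen_def by (rule hull_in) (rule bspec)
qed

text \<open>Riesz's projection theorem for one positive element: the projection is the supremum of all elements
  of the band between \<open>0\<close> and \<open>f\<close>. If \<open>f\<close> minus that supremum met some \<open>\<bar>b\<bar>\<close> in the band, the meet could
  be added to the supremum without leaving the band or exceeding \<open>f\<close>.\<close>

lemma band_proj_decomposition:
  fixes f z :: "'a::dedekind_complete_riesz_space"
  assumes f: "0 \<le> f"
  shows "0 \<le> band_proj z f" "band_proj z f \<le> f"
    "inf (band_proj z f) (f - band_proj z f) = 0" "inf \<bar>z\<bar> (f - band_proj z f) = 0"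
proof -
  let ?B = "band_gen z"
  have sub: "subspace ?B" and solid: "\<And>x y. y \<in> ?B \<Longrightarrow> \<bar>x\<bar> \<le> \<bar>y\<bar> \<Longrightarrow> x \<in> ?B"
    and Sup_in: "\<And>D. D \<subseteq> ?B \<Longrightarrow> D \<noteq> {} \<Longrightarrow> bdd_above D \<Longrightarrow> Sup D \<in> ?B"
    using is_band_band_gen[of z] unfolding is_band_def by blast+
  define D where "D = {b \<in> ?B. 0 \<le> b \<and> b \<le> f}"
  define p where "p = Sup D"
  have D: "0 \<in> D" "bdd_above D" using f subspace_0[OF sub] unfolding D_def by auto
  have pB: "p \<in> ?B" unfolding p_def using D by (intro Sup_in) (auto simp: D_def)
  have p0: "0 \<le> p" unfolding p_def using D by (intro cSup_upper)
  have pf: "p \<le> f" unfolding p_def using D by (intro cSup_least) (auto simp: D_def)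
  have disj: "inf (f - p) \<bar>b\<bar> = 0" if b: "b \<in> ?B" for b
  proof (rule order.antisym)
    let ?w = "inf (f - p) \<bar>b\<bar>"
    show w0: "0 \<le> ?w" using pf by simp
    have "?w \<in> ?B" using w0 by (intro solid[OF b]) simp
    then have "p + ?w \<in> ?B" using pB sub by (intro subspace_add)
    moreover have "p + ?w \<le> p + (f - p)" by (intro add_left_mono) simp
    ultimately have "p + ?w \<in> D" using p0 w0 unfolding D_def by auto
    then have "p + ?w \<le> p" unfolding p_def using D by (intro cSup_upper)
    then show "?w \<le> 0" by simp
  qed
  have "band_proj z f = p" unfolding band_proj_def
  proof (rule the_equality)
    show "p \<in> ?B \<and> f - p \<in> disj_compl ?B" using pB disj pf by (auto simp: disj_compl_def)
    fix q assume q: "q \<in> ?B \<and> f - q \<in> disj_compl ?B"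
    let ?d = "q - p"
    have dB: "?d \<in> ?B" using q pB sub by (auto intro: subspace_diff)
    have "inf \<bar>f - p\<bar> \<bar>?d\<bar> = 0" "inf \<bar>f - q\<bar> \<bar>?d\<bar> = 0"
      using disj[OF dB] pf q dB by (auto simp: disj_compl_def)
    then have "inf (\<bar>f - p\<bar> + \<bar>f - q\<bar>) \<bar>?d\<bar> = 0" by (rule disjoint_add)
    moreover have "\<bar>?d\<bar> \<le> \<bar>f - p\<bar> + \<bar>f - q\<bar>"
      using abs_triangle_ineq4[of "f - p" "f - q"] by simp
    ultimately have "\<bar>?d\<bar> = 0" by (simp add: inf_absorb2)
    then show "q = p" by simp
  qed
  moreover have "z \<in> ?B" unfolding band_gen_def by (rule hull_inc) simp
  ultimately show "0 \<le> band_proj z f" "band_proj z f \<le> f"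
    "inf (band_proj z f) (f - band_proj z f) = 0" "inf \<bar>z\<bar> (f - band_proj z f) = 0"
    using p0 pf disj[OF pB] disj[of z] by (simp_all add: inf.commute)
qed

section \<open>Components in f-algebras\<close>

lemma f_algebra_mult_right_mono:
  fixes a b c :: "'u::unital_f_algebra"
  assumes "a \<le> b" "0 \<le> c"
  shows "a * c \<le> b * c"
  using f_algebra_mult_nonneg[of "b - a" c] assms by (simp add: algebra_simps)

lemma f_algebra_disjoint_mult_right:
  fixes a b c :: "'u::unital_f_algebra"
  assumes "inf a b = 0" "0 \<le> c"
  shows "inf (a * c) (b * c) = 0"
  using f_algebra_disjoint[of a b c] f_algebra_disjoint[of b "a * c" c] assms
  by (simp add: inf.commute)

lemma f_algebra_disjoint_mult_zero:
  fixes a b :: "'u::unital_f_algebra"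
  assumes ab: "inf a b = 0"
  shows "a * b = 0"
proof -
  have "0 \<le> a" "0 \<le> b" using ab by (metis inf.cobounded1 inf.cobounded2)+
  then have "inf (a * b) b = 0" using ab f_algebra_disjoint by blast
  then have "inf (a * b) (a * b) = 0"
    using \<open>0 \<le> a\<close> f_algebra_disjoint[of b "a * b" a] by (simp add: inf.commute)
  then show ?thesis by simp
qed

lemma f_algebra_abs_disjoint_mult_zero:
  fixes a b :: "'u::unital_f_algebra"
  assumes ab: "inf \<bar>a\<bar> b = 0"
  shows "a * b = 0"
proof (rule order.antisym)
  have b: "0 \<le> b" using ab by (metis inf.cobounded2)
  have z: "\<bar>a\<bar> * b = 0" using ab by (rule f_algebra_disjoint_mult_zero)
  show "a * b \<le> 0" using f_algebra_mult_right_mono[OF abs_ge_self b, of a] z by simp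
  show "0 \<le> a * b" using f_algebra_mult_right_mono[OF abs_ge_minus_self b, of a] z by simp
qed

text \<open>A countable partition of the multiplicative unit into disjoint components. Every estimate between
  elements of the algebra can be checked piecewise, after multiplication by each component.\<close>

locale partition_of_unity =
  fixes P :: "nat \<Rightarrow> 'u::unital_f_algebra"
  assumes component: "inf (P k) (1 - P k) = 0"
    and disjoint: "j \<noteq> k \<Longrightarrow> inf (P j) (P k) = 0"
    and exhausts: "(\<And>N. (\<Sum>k<N. P k) \<le> b) \<Longrightarrow> 1 \<le> b"
begin

lemma nonneg: "0 \<le> P k"
  using component[of k] by (metis inf.cobounded1)

lemma le_one: "P k \<le> 1"
  using component[of k] by (metis inf.cobounded2 diff_ge_0_iff_ge)

lemma mult_self: "P k * P k = P k"
  using f_algebra_disjoint_mult_zero[of "1 - P k" "P k"] component[of k]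
  by (simp add: inf.commute algebra_simps)

lemma mult_other: "j \<noteq> k \<Longrightarrow> P j * P k = 0"
  by (rule f_algebra_disjoint_mult_zero) (rule disjoint)

text \<open>The part of \<open>v\<close> below \<open>1\<close> could be added to every partial sum without exceeding \<open>1\<close>; as the
  partial sums exhaust \<open>1\<close>, it vanishes. So \<open>v\<close> is disjoint from \<open>1\<close>, and multiplication by \<open>v\<close>, which
  preserves disjointness, makes \<open>v\<close> disjoint from itself.\<close>

lemma zero_if_disjoint:
  assumes v: "\<And>k. inf (P k) v = 0"
  shows "v = 0"
proof -
  have v0: "0 \<le> v" using v[of 0] by (metis inf.cobounded2)
  have one: "(0::'u) \<le> 1" using nonneg[of 0] le_one[of 0] by (rule order_trans)
  define w where "w = inf v 1"
  have w: "0 \<le> w" "w \<le> 1" "w \<le> v" using v0 one by (auto simp: w_def)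
  have "(\<Sum>k<N. P k) \<le> 1 - w" for N
  proof -
    have "inf (P k) w = 0" for k
      using disjoint_mono[of v "P k" w] v[of k] w by (simp add: inf.commute)
    then have "inf (\<Sum>k<N. P k) w = 0" using w by (intro disjoint_sum) auto
    then have "(\<Sum>k<N. P k) + w = sup (\<Sum>k<N. P k) w" by (rule disjoint_add_eq_sup)
    also have "(\<Sum>k<N. P k) \<le> 1"
      using disjoint nonneg le_one one by (intro sum_disjoint_le) auto
    then have "sup (\<Sum>k<N. P k) w \<le> 1" using w by simp
    finally show ?thesis by (simp add: algebra_simps)
  qed
  then have "1 \<le> 1 - w" by (rule exhausts)
  then have "w \<le> 0" by (simp add: le_diff_eq)
  then have "w = 0" using w by (intro order.antisym)
  then have "inf 1 v = 0" by (simp add: w_def inf.commute)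
  then have "inf (v * 1) v = 0" using v0 f_algebra_disjoint by blast
  then show "v = 0" by simp
qed

text \<open>Multiplication by a component keeps the positive and the negative part of \<open>a\<close> disjoint, so the
  negative part of each piece \<open>a * P k\<close> is the piece of the negative part; all of these vanish.\<close>

lemma nonneg_if_pieces:
  assumes a: "\<And>k. 0 \<le> a * P k"
  shows "0 \<le> a"
proof -
  define v where "v = sup (- a) 0"
  define u where "u = sup a 0"
  have v_eq: "- v = inf a 0" unfolding v_def by (simp add: neg_sup_eq_inf)
  have a_eq: "a = u - v" unfolding diff_conv_add_uminus v_eq u_def
    using add_eq_inf_sup[of a 0] by (simp add: add.commute)
  have nn: "0 \<le> u" "0 \<le> v" by (auto simp: u_def v_def)
  have "inf u v = v + inf (u - v) 0" by (simp add: add_inf_distrib_left)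
  also have "\<dots> = v + - v" unfolding v_eq a_eq[symmetric] ..
  finally have uv: "inf u v = 0" by simp
  have "inf (P k) v = 0" for k
  proof -
    have d: "inf (u * P k) (v * P k) = 0" using f_algebra_disjoint_mult_right[OF uv nonneg] .
    have "v * P k \<le> u * P k" using a[of k] unfolding a_eq by (simp add: algebra_simps)
    then have "v * P k = 0" using d by (simp add: inf_absorb2)
    then have "v = v * (1 - P k)" by (simp add: algebra_simps)
    moreover have "inf (v * (1 - P k)) (P k) = 0"
      using f_algebra_disjoint[of "1 - P k" "P k" v] component[of k] nn by (simp add: inf.commute)
    ultimately show ?thesis by (simp add: inf.commute)
  qed
  then have "v = 0" by (rule zero_if_disjoint)
  then show ?thesis using a_eq nn by simp
qed

lemma le_if_pieces: "(\<And>k. a * P k \<le> b * P k) \<Longrightarrow> a \<le> b"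
  using nonneg_if_pieces[of "b - a"] by (simp add: algebra_simps)

lemma partial_sum_mult:
  "(\<Sum>j<N. c j *\<^sub>R P j) * P k = (if k < N then c k *\<^sub>R P k else 0)"
proof -
  have "(\<Sum>j<N. c j *\<^sub>R P j) * P k = (\<Sum>j<N. if j = k then c k *\<^sub>R P k else 0)"
    unfolding sum_distrib_right by (intro sum.cong) (auto simp: mult_self mult_other)
  then show ?thesis by (simp add: sum.delta)
qed

lemma partial_sums_le:
  assumes "\<And>k. a * P k = c k *\<^sub>R P k" "\<And>k. 0 \<le> c k"
  shows "(\<Sum>j<N. c j *\<^sub>R P j) \<le> a"
proof (rule le_if_pieces)
  fix k
  have "0 \<le> c k *\<^sub>R P k" using assms(2) nonneg by (intro scaleR_nonneg_nonneg)
  then show "(\<Sum>j<N. c j *\<^sub>R P j) * P k \<le> a * P k"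
    by (simp add: partial_sum_mult assms(1))
qed

lemma le_if_partial_sums_le:
  assumes "\<And>k. a * P k = c k *\<^sub>R P k" "\<And>N. (\<Sum>j<N. c j *\<^sub>R P j) \<le> b"
  shows "a \<le> b"
proof (rule le_if_pieces)
  fix k
  show "a * P k \<le> b * P k"
    using f_algebra_mult_right_mono[OF assms(2)[of "Suc k"] nonneg[of k]]
    by (simp only: partial_sum_mult assms(1) lessI if_True)
qed

end

section \<open>Suprema in the completions\<close>

text \<open>The infinite distributive law. It follows from \<open>b + d = sup b d + inf b d\<close> and translation
  invariance of suprema.\<close>

lemma inf_Sup_le:
  fixes b c :: "'a::dedekind_complete_riesz_space"
  assumes "D \<noteq> {}" "bdd_above D" "\<And>d. d \<in> D \<Longrightarrow> inf b d \<le> c"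
  shows "inf b (Sup D) \<le> c"
proof -
  let ?S = "Sup D"
  have "d \<le> c + sup b ?S - b" if "d \<in> D" for d
  proof -
    have "b + d = sup b d + inf b d" by (rule add_eq_inf_sup[unfolded add.commute[of "inf _ _"]])
    also have "\<dots> \<le> sup b ?S + c"
      using assms(3)[OF that] cSup_upper[OF that assms(2)] by (intro add_mono sup_mono) auto
    finally show ?thesis by (simp add: le_diff_eq add.commute)
  qed
  then have "?S \<le> c + sup b ?S - b" using assms(1) by (intro cSup_least)
  then have "b + ?S \<le> sup b ?S + c" by (simp add: le_diff_eq add.commute)
  moreover have "b + ?S = sup b ?S + inf b ?S" by (rule add_eq_inf_sup[unfolded add.commute[of "inf _ _"]])
  ultimately show ?thesis by simp
qed

text \<open>The order of the sup-completion is defined through hulls of lower sets. This lemma brings it back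
  to the original space: an element below a supremum is the supremum of its truncations by the members
  of the family. The set \<open>A\<close> of all elements with this property is shown to be one of the sets that
  represent elements of the sup-completion.\<close>

lemma le_if_sc_embed_le_Sup:
  fixes b c :: "'a::dedekind_complete_riesz_space"
  assumes ne: "D \<noteq> {}" and b: "sc_embed b \<le> Sup (sc_embed ` D)"
    and c: "\<And>d. d \<in> D \<Longrightarrow> inf b d \<le> c"
  shows "b \<le> c"
proof -
  \<comment> \<open>\<open>A\<close> consists of the \<open>a\<close> that are the supremum of all \<open>inf a d\<close> with \<open>d \<in> D\<close>.\<close>
  define A where "A = {a. \<forall>c. (\<forall>d\<in>D. inf a d \<le> c) \<longrightarrow> a \<le> c}"
  have DA: "D \<subseteq> A" unfolding A_def by fastforce
  have "sup_closed A" unfolding sup_closed_def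
  proof (intro conjI ballI allI impI)
    show "A \<noteq> {}" using DA ne by blast
    show "a' \<in> A" if a: "a \<in> A" and a': "a' \<le> a" for a a'
      unfolding A_def
    proof (intro CollectI allI impI)
      fix c assume c: "\<forall>d\<in>D. inf a' d \<le> c"
      let ?K = "(\<lambda>d. inf a d) ` D"
      have K: "?K \<noteq> {}" "bdd_above ?K" using ne by (auto intro: bdd_aboveI[of _ a])
      have "\<forall>d\<in>D. inf a d \<le> Sup ?K" using K by (auto intro: cSup_upper)
      then have "a \<le> Sup ?K" using a unfolding A_def by blast
      then have "a' = inf a' (Sup ?K)" using a' by (simp add: inf_absorb1)
      also have "\<dots> \<le> c"
      proof (rule inf_Sup_le[OF K])
        fix k assume "k \<in> ?K"
        then obtain d where "d \<in> D" "k = inf a d" by blast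
        then show "inf a' k \<le> c" using c a' by (simp add: inf_absorb1 flip: inf.assoc)
      qed
      finally show "a' \<le> c" .
    qed
    show "Sup S \<in> A" if S: "S \<subseteq> A" "S \<noteq> {} \<and> bdd_above S" for S
      unfolding A_def
    proof (intro CollectI allI impI)
      fix c assume c: "\<forall>d\<in>D. inf (Sup S) d \<le> c"
      show "Sup S \<le> c"
      proof (rule cSup_least)
        fix s assume s: "s \<in> S"
        have "\<forall>d\<in>D. inf s d \<le> c"
          using c inf_mono[OF cSup_upper[OF s] order.refl] S by (meson order_trans)
        then show "s \<le> c" using S s unfolding A_def by blast
      qed (use S in auto)
    qed
  qed
  then have Rep: "Rep_sup_completion (Abs_sup_completion A) = A" by simp
  have "Sup (sc_embed ` D) \<le> Abs_sup_completion A"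
    using DA ne by (intro cSup_least) (auto simp: sc_embed_le_iff_mem Rep)
  then have "b \<in> A" using b order_trans sc_embed_le_iff_mem Rep by blast
  then show ?thesis using c unfolding A_def by blast
qed

lemma sc_embed_sum: "sc_embed (\<Sum>k\<in>A. f k) = (\<Sum>k\<in>A. sc_embed (f k))"
  by (induction A rule: infinite_finite_induct) (simp_all add: sc_embed_zero sc_embed_add)

context universal_completion
begin

lemma le_iff: "\<iota> a \<le> \<iota> b \<longleftrightarrow> a \<le> b"
  using inj by (simp add: le_iff_inf inf[symmetric] inj_eq)

lemma abs: "\<iota> \<bar>a\<bar> = \<bar>\<iota> a\<bar>"
  by (simp add: abs_lattice sup linear_neg[OF linear])

lemma nonneg_iff: "0 \<le> \<iota> a \<longleftrightarrow> 0 \<le> a"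
  using le_iff[of 0 a] by (simp add: linear_0[OF linear])

text \<open>An order dense embedding preserves suprema: otherwise some positive \<open>f\<close> fits into the gap between
  \<open>\<iota> (Sup D)\<close> and an upper bound of the image, and \<open>Sup D - f\<close> would still bound \<open>D\<close>.\<close>

lemma Sup_le:
  assumes "D \<noteq> {}" "bdd_above D" "\<And>d. d \<in> D \<Longrightarrow> \<iota> d \<le> c"
  shows "\<iota> (Sup D) \<le> c"
proof (rule ccontr)
  assume not_le: "\<not> \<iota> (Sup D) \<le> c"
  define w where "w = \<iota> (Sup D) - inf c (\<iota> (Sup D))"
  have "0 \<le> w" unfolding w_def using inf_le2 by (rule diff_ge_0_iff_ge[THEN iffD2])
  moreover have "w \<noteq> 0"
  proof
    assume "w = 0"
    then have "\<iota> (Sup D) = inf c (\<iota> (Sup D))" unfolding w_def by (rule right_minus_eq[THEN iffD1])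
    then show False using not_le by (metis inf_le1)
  qed
  ultimately obtain f where f: "0 < \<iota> f" "\<iota> f \<le> w" using order_dense[of w] by (auto simp: less_le)
  have "d \<le> Sup D - f" if "d \<in> D" for d
  proof -
    have "\<iota> d \<le> inf c (\<iota> (Sup D))"
      using assms(3)[OF that] cSup_upper[OF that assms(2)] by (simp add: le_iff)
    also have "\<dots> = \<iota> (Sup D) - w" by (simp add: w_def)
    also have "\<dots> \<le> \<iota> (Sup D) - \<iota> f" using f(2) by (rule diff_left_mono)
    finally have "\<iota> d \<le> \<iota> (Sup D - f)" by (simp add: linear_diff[OF linear])
    then show ?thesis by (simp add: le_iff)
  qed
  then have "Sup D \<le> Sup D - f" using assms(1) by (intro cSup_least)
  then have "\<iota> f \<le> \<iota> 0" by (simp add: le_iff)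
  then show False using f(1) by (simp add: linear_0[OF linear])
qed

text \<open>An element \<open>a \<ge> 0\<close> of the universal completion is represented in the sup-completion by the set of
  all \<open>b\<close> with \<open>\<iota> b \<le> a\<close>. This set needs no closure because \<open>\<iota>\<close> preserves suprema.\<close>

lemma sc_embed_le_u_to_s_iff:
  assumes a: "0 \<le> a"
  shows "sc_embed b \<le> u_to_s \<iota> a \<longleftrightarrow> \<iota> b \<le> a"
proof -
  let ?A = "{b. \<iota> b \<le> a}" and ?D = "{b. 0 \<le> b \<and> \<iota> b \<le> a}"
  have zero: "0 \<in> ?D" using a by (simp add: linear_0[OF linear])
  have "sup_closed ?A" unfolding sup_closed_def
  proof (intro conjI ballI allI impI)
    show "?A \<noteq> {}" using zero by blast
    show "b' \<in> ?A" if "b \<in> ?A" "b' \<le> b" for b b'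
      using that order_trans[of "\<iota> b'" "\<iota> b" a] by (simp add: le_iff)
    show "Sup D \<in> ?A" if "D \<subseteq> ?A" "D \<noteq> {} \<and> bdd_above D" for D
      using that by (auto intro!: Sup_le)
  qed
  then have Rep: "Rep_sup_completion (Abs_sup_completion ?A) = ?A" by simp
  show ?thesis
  proof
    assume b: "sc_embed b \<le> u_to_s \<iota> a"
    have "u_to_s \<iota> a \<le> Abs_sup_completion ?A"
      unfolding u_to_s_def using zero by (intro cSup_least) (auto simp: sc_embed_le_iff_mem Rep)
    then have "sc_embed b \<le> Abs_sup_completion ?A" using b by (rule order_trans[rotated])
    then show "\<iota> b \<le> a" by (simp add: sc_embed_le_iff_mem Rep)
  next
    assume "\<iota> b \<le> a"
    then have "\<iota> (sup b 0) \<le> a" using a by (simp add: sup linear_0[OF linear])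
    then have "sc_embed (sup b 0) \<le> u_to_s \<iota> a"
      unfolding u_to_s_def by (intro cSup_upper) auto
    then show "sc_embed b \<le> u_to_s \<iota> a"
      by (rule order_trans[rotated]) simp
  qed
qed

text \<open>If \<open>a\<close> exceeded \<open>a'\<close>, order density would put some \<open>\<iota> f > 0\<close> below \<open>a - inf a a'\<close>. Adding \<open>f\<close>
  to an element below \<open>inf a a'\<close> gives one below \<open>a\<close>, hence below \<open>a'\<close>, hence below \<open>inf a a'\<close>. So all
  multiples of \<open>f\<close> would stay below \<open>inf a a'\<close>.\<close>

lemma le_if_u_to_s_le:
  assumes nn: "0 \<le> a" "0 \<le> a'" and le: "u_to_s \<iota> a \<le> u_to_s \<iota> a'"
  shows "a \<le> a'"
proof (rule ccontr)
  assume not_le: "\<not> a \<le> a'"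
  define w where "w = a - inf a a'"
  have "0 \<le> w" unfolding w_def using inf_le1 by (rule diff_ge_0_iff_ge[THEN iffD2])
  moreover have "w \<noteq> 0"
  proof
    assume "w = 0"
    then have "a = inf a a'" unfolding w_def by (rule right_minus_eq[THEN iffD1])
    then show False using not_le by (metis inf_le2)
  qed
  ultimately obtain f where f: "0 < \<iota> f" "\<iota> f \<le> w" using order_dense[of w] by (auto simp: less_le)
  have "real m *\<^sub>R \<iota> f \<le> inf a a'" for m
  proof (induction m)
    case 0
    then show ?case using nn by simp
  next
    case (Suc m)
    have "real (Suc m) *\<^sub>R \<iota> f = real m *\<^sub>R \<iota> f + \<iota> f" by (simp add: algebra_simps)
    also have "\<dots> \<le> inf a a' + w" using Suc f(2) by (rule add_mono)
    also have "\<dots> = a" by (simp only: w_def add_diff_eq add_diff_cancel_left')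
    finally have a: "real (Suc m) *\<^sub>R \<iota> f \<le> a" .
    have "\<iota> (real (Suc m) *\<^sub>R f) \<le> a" using a by (simp only: linear_scale[OF linear])
    then have "sc_embed (real (Suc m) *\<^sub>R f) \<le> u_to_s \<iota> a" using nn by (simp only: sc_embed_le_u_to_s_iff)
    then have "sc_embed (real (Suc m) *\<^sub>R f) \<le> u_to_s \<iota> a'" using le by (rule order_trans)
    then have "\<iota> (real (Suc m) *\<^sub>R f) \<le> a'" using nn by (simp only: sc_embed_le_u_to_s_iff)
    then have "real (Suc m) *\<^sub>R \<iota> f \<le> a'" by (simp only: linear_scale[OF linear])
    with a show ?case by (rule le_infI)
  qed
  then have "\<iota> f \<le> 0" by (rule archimedean)
  then show False using f(1) by simp
qed

lemma inj_on_u_to_s: "inj_on (u_to_s \<iota>) {0..}"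
  by (rule inj_onI, rule order.antisym) (auto intro!: le_if_u_to_s_le)

lemma u_to_s_Sup:
  assumes ne: "D \<noteq> {}" and nn: "\<And>d. d \<in> D \<Longrightarrow> 0 \<le> d" and bdd: "bdd_above (\<iota> ` D)"
  shows "0 \<le> Sup (\<iota> ` D)" "u_to_s \<iota> (Sup (\<iota> ` D)) = Sup (sc_embed ` D)"
proof -
  obtain d where d: "d \<in> D" using ne by blast
  have "0 \<le> \<iota> d" using nn[OF d] by (simp add: nonneg_iff)
  also have "\<iota> d \<le> Sup (\<iota> ` D)" using d bdd by (intro cSup_upper) auto
  finally show nonneg: "0 \<le> Sup (\<iota> ` D)" .
  let ?s = "Sup (sc_embed ` D)"
  show "u_to_s \<iota> (Sup (\<iota> ` D)) = ?s"
  proof (rule order.antisym)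
    show "?s \<le> u_to_s \<iota> (Sup (\<iota> ` D))"
      using ne bdd by (intro cSup_least) (auto simp: sc_embed_le_u_to_s_iff[OF nonneg] intro!: cSup_upper)
    show "u_to_s \<iota> (Sup (\<iota> ` D)) \<le> ?s"
      unfolding less_eq_sup_completion_def
    proof
      fix b assume "b \<in> Rep_sup_completion (u_to_s \<iota> (Sup (\<iota> ` D)))"
      then have b: "\<iota> b \<le> Sup (\<iota> ` D)"
        by (simp flip: sc_embed_le_iff_mem add: sc_embed_le_u_to_s_iff[OF nonneg])
      let ?K = "(\<lambda>d. inf b d) ` D"
      have K: "?K \<noteq> {}" "bdd_above ?K" using ne by (auto intro: bdd_aboveI[of _ b])
      have "\<iota> b = inf (\<iota> b) (Sup (\<iota> ` D))" using b by (simp add: inf_absorb1)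
      also have "\<dots> \<le> \<iota> (Sup ?K)"
      proof (rule inf_Sup_le)
        fix u assume "u \<in> \<iota> ` D"
        then obtain d where d: "d \<in> D" "u = \<iota> d" by blast
        then have "inf b d \<le> Sup ?K" using K by (intro cSup_upper) auto
        then show "inf (\<iota> b) u \<le> \<iota> (Sup ?K)" using d by (simp add: le_iff flip: inf)
      qed (use ne bdd in auto)
      finally have "b \<le> Sup ?K" by (simp add: le_iff)
      moreover have "Sup ?K \<in> Rep_sup_completion ?s"
      proof (rule sup_closed_Sup)
        show "?K \<subseteq> Rep_sup_completion ?s"
        proof
          fix k assume "k \<in> ?K"
          then obtain d where d: "d \<in> D" "k = inf b d" by blast
          have "sc_embed k \<le> sc_embed d" using d by simp
          also have "\<dots> \<le> ?s" using d by (intro cSup_upper) auto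
          finally show "k \<in> Rep_sup_completion ?s" by (simp add: sc_embed_le_iff_mem)
        qed
      qed (use K in auto)
      ultimately show "b \<in> Rep_sup_completion ?s" using sup_closed_lower sup_closed_Rep by blast
    qed
  qed
qed

text \<open>Membership in the universal completion becomes plain boundedness. This is how both conditions of
  the theorem are compared.\<close>

lemma Sup_mem_u_to_s_iff:
  assumes ne: "D \<noteq> {}" and nn: "\<And>d. d \<in> D \<Longrightarrow> 0 \<le> d"
  shows "Sup (sc_embed ` D) \<in> u_to_s \<iota> ` {0..} \<longleftrightarrow> bdd_above (\<iota> ` D)"
proof
  assume "bdd_above (\<iota> ` D)"
  from u_to_s_Sup[OF ne nn this] show "Sup (sc_embed ` D) \<in> u_to_s \<iota> ` {0..}"
    by (intro image_eqI[of _ _ "Sup (\<iota> ` D)"]) auto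
next
  assume "Sup (sc_embed ` D) \<in> u_to_s \<iota> ` {0..}"
  then obtain a where a: "0 \<le> a" "Sup (sc_embed ` D) = u_to_s \<iota> a" by auto
  have "\<iota> d \<le> a" if "d \<in> D" for d
    using sc_embed_le_u_to_s_iff[OF a(1), of d] that
    by (auto simp flip: a(2) intro: cSup_upper)
  then show "bdd_above (\<iota> ` D)" by (intro bdd_aboveI[of _ a]) auto
qed

end

section \<open>The extended expectation along increasing sequences\<close>

context conditional_riesz_triple
begin

lemma T_mono: "a \<le> b \<Longrightarrow> T a \<le> T b"
  using positive[of "b - a"] by (simp add: linear_diff[OF linear])

text \<open>Order continuity, specialised to an increasing sequence with supremum \<open>b\<close>: its image filter order
  converges to \<open>b\<close>, with the differences \<open>b - y N\<close> as dominating net.\<close>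

lemma T_le_if_increasing:
  assumes y: "incseq y" "\<And>N. y N \<le> b" "\<And>c. (\<And>N. y N \<le> c) \<Longrightarrow> b \<le> c"
    and c: "\<And>N. T (y N) \<le> c"
  shows "T b \<le> c"
proof -
  define F where "F = filtermap y sequentially"
  have "o_tendsto (\<lambda>x. x) b F"
    unfolding o_tendsto_def
  proof (intro exI[of _ "range (\<lambda>N. b - y N)"] conjI ballI)
    let ?Y = "range (\<lambda>N. b - y N)"
    show "?Y \<noteq> {}" by simp
    show "\<exists>c\<in>?Y. c \<le> a \<and> c \<le> a'" if a: "a \<in> ?Y" "a' \<in> ?Y" for a a'
    proof -
      obtain M N where "a = b - y M" "a' = b - y N" using a by blast
      then show ?thesis using y(1)
        by (intro bexI[of _ "b - y (max M N)"]) (auto simp: incseq_def)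
    qed
    show nn: "0 \<le> a" if "a \<in> ?Y" for a using that y(2) by auto
    show "Inf ?Y = 0"
    proof (rule order.antisym)
      have bdd: "bdd_below ?Y" using nn by (intro bdd_belowI[of _ 0])
      have "y N \<le> b - Inf ?Y" for N
        using cInf_lower[OF rangeI bdd, of N] by (simp add: le_diff_eq add.commute)
      then have "b \<le> b - Inf ?Y" by (rule y(3))
      then show "Inf ?Y \<le> 0" by simp
      show "0 \<le> Inf ?Y" using nn by (intro cInf_greatest) auto
    qed
    fix a assume "a \<in> ?Y"
    then obtain N where N: "a = b - y N" by blast
    have "\<bar>y M - b\<bar> \<le> a" if "N \<le> M" for M
    proof -
      have "\<bar>y M - b\<bar> = b - y M" using y(2)[of M] by (simp add: abs_of_nonpos)
      also have "\<dots> \<le> a" using incseqD[OF y(1) that] unfolding N by simp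
      finally show ?thesis .
    qed
    then show "eventually (\<lambda>i. \<bar>i - b\<bar> \<le> a) F"
      unfolding F_def eventually_filtermap eventually_sequentially by blast
  qed
  then have "o_tendsto T (T b) F" using order_cont unfolding order_continuous_def by blast
  then obtain Z where Z: "Z \<noteq> {}" "Inf Z = 0" "\<And>z. z \<in> Z \<Longrightarrow> eventually (\<lambda>i. \<bar>T i - T b\<bar> \<le> z) F"
    unfolding o_tendsto_def by blast
  have "T b - c \<le> z" if z: "z \<in> Z" for z
  proof -
    obtain N where N: "\<bar>T (y N) - T b\<bar> \<le> z"
      using Z(3)[OF z] unfolding F_def eventually_filtermap eventually_sequentially by blast
    have "T b - c \<le> T b - T (y N)" using c by (intro diff_left_mono)
    also have "\<dots> \<le> \<bar>T (y N) - T b\<bar>" using abs_ge_minus_self[of "T (y N) - T b"] by simp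
    finally show ?thesis using N by (rule order_trans)
  qed
  then have "T b - c \<le> Inf Z" using Z(1) by (intro cInf_greatest)
  then show ?thesis using Z(2) by simp
qed

text \<open>Any \<open>b \<ge> 0\<close> below the supremum is the limit of its truncations \<open>inf b (y N)\<close>, whose images under
  \<open>T\<close> are below \<open>T (y N)\<close>.\<close>

lemma T_sup_SUP:
  assumes y: "incseq y" "\<And>N. 0 \<le> y N"
  shows "T_sup T (SUP N. sc_embed (y N)) = (SUP N. sc_embed (T (y N)))"
proof (rule order.antisym)
  let ?x = "SUP N. sc_embed (y N)" and ?s = "SUP N. sc_embed (T (y N))"
  show "?s \<le> T_sup T ?x"
  proof (rule cSUP_least)
    fix N
    have "sc_embed (y N) \<le> ?x" by (intro cSUP_upper) auto
    then show "sc_embed (T (y N)) \<le> T_sup T ?x"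
      unfolding T_sup_def using y(2) by (intro cSUP_upper) auto
  qed simp
  show "T_sup T ?x \<le> ?s"
    unfolding T_sup_def
  proof (rule cSUP_least)
    have "sc_embed 0 \<le> sc_embed (y 0)" using y(2) by simp
    also have "\<dots> \<le> ?x" by (intro cSUP_upper) auto
    finally show "{a. 0 \<le> a \<and> sc_embed a \<le> ?x} \<noteq> {}" by blast
    fix b assume "b \<in> {a. 0 \<le> a \<and> sc_embed a \<le> ?x}"
    then have b: "sc_embed b \<le> Sup (sc_embed ` range y)" by (simp add: image_image)
    let ?z = "\<lambda>N. inf b (y N)"
    let ?K = "range (\<lambda>N. T (?z N))"
    have bdd: "bdd_above ?K" by (intro bdd_aboveI[of _ "T b"]) (auto intro: T_mono)
    have "T b \<le> Sup ?K"
    proof (rule T_le_if_increasing)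
      show "incseq ?z" using y(1) by (auto simp: incseq_def intro: le_infI2)
      show "?z N \<le> b" for N by simp
      show "b \<le> c" if "\<And>N. ?z N \<le> c" for c
        using b by (rule le_if_sc_embed_le_Sup[rotated]) (auto intro: that)
      show "T (?z N) \<le> Sup ?K" for N using bdd by (intro cSup_upper) auto
    qed
    moreover have "Sup ?K \<in> Rep_sup_completion ?s"
    proof (rule sup_closed_Sup)
      show "?K \<subseteq> Rep_sup_completion ?s"
      proof
        fix k assume "k \<in> ?K"
        then obtain N where N: "k = T (?z N)" by blast
        have "sc_embed k \<le> sc_embed (T (y N))" unfolding N by (simp add: T_mono)
        also have "\<dots> \<le> ?s" by (intro cSUP_upper) auto
        finally show "k \<in> Rep_sup_completion ?s" by (simp add: sc_embed_le_iff_mem)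
      qed
    qed (use bdd in auto)
    ultimately show "sc_embed (T b) \<le> ?s"
      unfolding sc_embed_le_iff_mem using sup_closed_lower sup_closed_Rep by blast
  qed
qed

end

section \<open>Falling factorials\<close>

lemma falling_Suc: "falling t (Suc n) = falling t n * (t - real n)"
  by (simp add: falling_def)

lemma falling_eq_0: "k < n \<Longrightarrow> falling (real k) n = 0"
  unfolding falling_def by (rule prod_zero) auto

lemma falling_nonneg: "0 \<le> falling (real k) n"
proof (cases "k < n")
  case False
  then show ?thesis unfolding falling_def by (intro prod_nonneg) auto
qed (simp add: falling_eq_0)

lemma falling_le_power: "falling (real k) n \<le> real k ^ n"
proof (cases "k < n")
  case False
  then have "falling (real k) n \<le> (\<Prod>i<n. real k)" unfolding falling_def by (intro prod_mono) auto
  then show ?thesis by simp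
qed (simp add: falling_eq_0)

text \<open>Each factor \<open>k - i\<close> with \<open>i < n\<close> is at least \<open>k / 2\<close>.\<close>

lemma power_le_falling:
  assumes "2 * n \<le> k"
  shows "real k ^ n \<le> 2 ^ n * falling (real k) n"
proof -
  have "real k ^ n = 2 ^ n * (\<Prod>i<n. real k / 2)" by (simp add: power_divide)
  also have "\<dots> \<le> 2 ^ n * falling (real k) n"
    unfolding falling_def using assms by (intro mult_left_mono prod_mono) auto
  finally show ?thesis .
qed

text \<open>After the shift \<open>k \<mapsto> k + n\<close> the series is the \<open>n\<close>-fold formal derivative of the geometric series.\<close>

lemma summable_falling:
  assumes s: "0 \<le> s" "s < 1"
  shows "summable (\<lambda>k. falling (real k) n * s ^ (k - n))"
proof -
  have *: "\<forall>t. norm t < 1 \<longrightarrow> summable (\<lambda>k. falling (real (k + n)) n * t ^ k)"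
  proof (induction n)
    case 0
    then show ?case by (auto simp: falling_def intro: summable_geometric)
  next
    case (Suc n)
    show ?case
    proof (intro allI impI)
      fix t :: real assume t: "norm t < 1"
      have "summable (\<lambda>k. diffs (\<lambda>k. falling (real (k + n)) n) k * t ^ k)"
        using t by (rule termdiff_converges) (use Suc in blast)
      moreover have "diffs (\<lambda>k. falling (real (k + n)) n) k = falling (real (k + Suc n)) (Suc n)" for k
        by (simp add: diffs_def falling_Suc algebra_simps)
      ultimately show "summable (\<lambda>k. falling (real (k + Suc n)) (Suc n) * t ^ k)" by simp
    qed
  qed
  have "summable (\<lambda>k. falling (real (k + n)) n * s ^ (k + n - n))" using * s by simp
  then show ?thesis by (subst (asm) summable_iff_shift[of "\<lambda>k. falling (real k) n * s ^ (k - n)"])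
qed

text \<open>The linearisation error of a monomial, multiplied by the falling factorial. The factor \<open>m (m - 1)\<close>
  of the usual bound for exponent \<open>m = k - n\<close> raises the order of the falling factorial by two, so the
  right-hand side is again a term of a summable series.\<close>

lemma falling_power_remainder:
  assumes "\<bar>s\<bar> \<le> K" "\<bar>t\<bar> \<le> K" "t \<noteq> s"
  shows "\<bar>falling (real k) n * ((t ^ (k - n) - s ^ (k - n)) / (t - s))
      - falling (real k) (Suc n) * s ^ (k - Suc n)\<bar>
    \<le> \<bar>t - s\<bar> * (falling (real k) (n + 2) * K ^ (k - (n + 2)))"
proof (cases "k < n")
  case True
  then show ?thesis by (simp add: falling_eq_0)
next
  case False
  define m where "m = k - n"
  have m: "real m = real k - real n" using False by (simp add: m_def)
  have exps: "k - Suc n = m - Suc 0" "k - (n + 2) = m - 2" by (auto simp: m_def)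
  have f1: "falling (real k) (Suc n) = falling (real k) n * real m"
    unfolding falling_Suc m ..
  have mm: "real m * (real k - real (Suc n)) = real m * real (m - Suc 0)"
    using False by (cases m) (auto simp: m_def)
  have f2: "falling (real k) (n + 2) = falling (real k) n * (real m * real (m - Suc 0))"
    unfolding mm[symmetric] by (simp add: falling_Suc m)
  have r: "\<bar>(t ^ m - s ^ m) / (t - s) - real m * s ^ (m - Suc 0)\<bar>
      \<le> real m * real (m - Suc 0) * K ^ (m - 2) * \<bar>t - s\<bar>"
    using lemma_termdiff3[of "t - s" s K m] assms by simp
  have "\<bar>falling (real k) n * ((t ^ m - s ^ m) / (t - s)) - falling (real k) (Suc n) * s ^ (k - Suc n)\<bar>
      = falling (real k) n * \<bar>(t ^ m - s ^ m) / (t - s) - real m * s ^ (m - Suc 0)\<bar>"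
    using falling_nonneg[of k n]
    by (simp only: f1 exps abs_mult abs_of_nonneg mult.assoc flip: right_diff_distrib)
  also have "\<dots> \<le> falling (real k) n * (real m * real (m - Suc 0) * K ^ (m - 2) * \<bar>t - s\<bar>)"
    using r falling_nonneg by (rule mult_left_mono)
  also have "\<dots> = \<bar>t - s\<bar> * (falling (real k) (n + 2) * K ^ (k - (n + 2)))"
    unfolding f2 exps by (simp add: mult_ac)
  finally show ?thesis by (simp add: m_def)
qed

section \<open>Power series with order bounded coefficients\<close>

text \<open>Coefficients in an order interval \<open>[0, u]\<close>: sums \<open>\<Sum>k. c k *\<^sub>R \<mu> k\<close> with absolutely summable real
  \<open>c\<close> then converge relatively uniformly with regulator \<open>u\<close>, and estimates on \<open>c\<close> carry over.\<close>

locale order_bounded_sequence =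
  fixes \<mu> :: "nat \<Rightarrow> 'u::dedekind_complete_riesz_space" and u :: 'u
  assumes nonneg: "0 \<le> \<mu> k" and le_bound: "\<mu> k \<le> u"
begin

lemma bound_nonneg: "0 \<le> u"
  using nonneg le_bound order_trans by blast

lemma scaleR_le: "a \<le> b \<Longrightarrow> 0 \<le> b \<Longrightarrow> a *\<^sub>R \<mu> k \<le> b *\<^sub>R u"
  using scaleR_right_mono[of a b "\<mu> k"] scaleR_left_mono[of "\<mu> k" u b] nonneg le_bound
  by (meson order_trans)

text \<open>Convergence of the series relatively uniformly with regulator \<open>u\<close>. Unlike the supremum of the partial
  sums this notion is linear in \<open>c\<close>, as is needed for difference quotients.\<close>

definition has_usum :: "(nat \<Rightarrow> real) \<Rightarrow> 'u \<Rightarrow> bool" where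
  "has_usum c L \<longleftrightarrow>
     (\<exists>\<epsilon>. \<epsilon> \<longlonglongrightarrow> 0 \<and> (\<forall>N. \<bar>(\<Sum>k<N. c k *\<^sub>R \<mu> k) - L\<bar> \<le> \<epsilon> N *\<^sub>R u))"

lemma has_usum_Sup:
  assumes c: "\<And>k. 0 \<le> c k" and sm: "summable c"
  shows "has_usum c (SUP N. \<Sum>k<N. c k *\<^sub>R \<mu> k)"
    and "bdd_above (range (\<lambda>N. \<Sum>k<N. c k *\<^sub>R \<mu> k))"
proof -
  let ?S = "\<lambda>N. \<Sum>k<N. c k *\<^sub>R \<mu> k"
  let ?\<epsilon> = "\<lambda>N. suminf c - (\<Sum>k<N. c k)"
  have \<epsilon>0: "0 \<le> ?\<epsilon> N" for N using sum_le_suminf[OF sm, of "{..<N}"] c by simp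
  have tail: "?S M \<le> ?S N + ?\<epsilon> N *\<^sub>R u" for M N
  proof (cases "M \<le> N")
    case True
    have "?S M \<le> ?S N" using True c nonneg by (intro sum_mono2) (auto intro: scaleR_nonneg_nonneg)
    then show ?thesis using add_mono[of "?S M" "?S N" 0 "?\<epsilon> N *\<^sub>R u"] \<epsilon>0 bound_nonneg
      by (simp only: add_0_right scaleR_nonneg_nonneg simp_thms)
  next
    case False
    then have split: "{..<M} = {..<N} \<union> {N..<M}" by auto
    have "?S M = ?S N + (\<Sum>k=N..<M. c k *\<^sub>R \<mu> k)"
      unfolding split by (subst sum.union_disjoint) auto
    also have "(\<Sum>k=N..<M. c k *\<^sub>R \<mu> k) \<le> (\<Sum>k=N..<M. c k *\<^sub>R u)"
      using c by (intro sum_mono scaleR_le) auto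
    also have "\<dots> = (\<Sum>k=N..<M. c k) *\<^sub>R u" by (simp add: scaleR_sum_left)
    also have "(\<Sum>k=N..<M. c k) \<le> ?\<epsilon> N"
    proof -
      have "(\<Sum>k<N. c k) + (\<Sum>k=N..<M. c k) = (\<Sum>k<M. c k)"
        unfolding split by (subst sum.union_disjoint) auto
      also have "\<dots> \<le> suminf c" using sm c by (intro sum_le_suminf) auto
      finally show ?thesis by simp
    qed
    then have "(\<Sum>k=N..<M. c k) *\<^sub>R u \<le> ?\<epsilon> N *\<^sub>R u" using bound_nonneg by (rule scaleR_right_mono)
    finally show ?thesis by simp
  qed
  show bdd: "bdd_above (range ?S)" using tail[of _ 0] by (intro bdd_aboveI[of _ "?S 0 + ?\<epsilon> 0 *\<^sub>R u"]) auto
  let ?L = "SUP N. ?S N"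
  have "\<bar>?S N - ?L\<bar> \<le> ?\<epsilon> N *\<^sub>R u" for N
  proof -
    have "?S N \<le> ?L" using bdd by (intro cSUP_upper) auto
    then have "\<bar>?S N - ?L\<bar> = ?L - ?S N" by (simp add: abs_of_nonpos)
    moreover have "?L \<le> ?S N + ?\<epsilon> N *\<^sub>R u" using tail by (intro cSUP_least) auto
    ultimately show ?thesis by (simp add: diff_le_eq add.commute)
  qed
  moreover have "?\<epsilon> \<longlonglongrightarrow> suminf c - suminf c" using summable_LIMSEQ[OF sm] by (intro tendsto_intros)
  ultimately show "has_usum c ?L" unfolding has_usum_def by auto
qed

lemma has_usum_diff:
  assumes "has_usum c L" "has_usum d M"
  shows "has_usum (\<lambda>k. c k - d k) (L - M)"
proof -
  obtain \<epsilon> where \<epsilon>: "\<epsilon> \<longlonglongrightarrow> 0" "\<And>N. \<bar>(\<Sum>k<N. c k *\<^sub>R \<mu> k) - L\<bar> \<le> \<epsilon> N *\<^sub>R u"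
    using assms(1) unfolding has_usum_def by blast
  obtain \<eta> where \<eta>: "\<eta> \<longlonglongrightarrow> 0" "\<And>N. \<bar>(\<Sum>k<N. d k *\<^sub>R \<mu> k) - M\<bar> \<le> \<eta> N *\<^sub>R u"
    using assms(2) unfolding has_usum_def by blast
  have "\<bar>(\<Sum>k<N. (c k - d k) *\<^sub>R \<mu> k) - (L - M)\<bar> \<le> (\<epsilon> N + \<eta> N) *\<^sub>R u" for N
  proof -
    have eq: "(\<Sum>k<N. (c k - d k) *\<^sub>R \<mu> k) - (L - M)
        = ((\<Sum>k<N. c k *\<^sub>R \<mu> k) - L) - ((\<Sum>k<N. d k *\<^sub>R \<mu> k) - M)"
      by (simp add: scaleR_left_diff_distrib sum_subtractf)
    show ?thesis
      unfolding eq scaleR_left_distrib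
      by (rule order_trans[OF abs_triangle_ineq4 add_mono[OF \<epsilon>(2) \<eta>(2)]])
  qed
  moreover have "(\<lambda>N. \<epsilon> N + \<eta> N) \<longlonglongrightarrow> 0" using tendsto_add[OF \<epsilon>(1) \<eta>(1)] by simp
  ultimately show ?thesis unfolding has_usum_def by blast
qed

lemma has_usum_scale:
  assumes "has_usum c L"
  shows "has_usum (\<lambda>k. r * c k) (r *\<^sub>R L)"
proof -
  obtain \<epsilon> where \<epsilon>: "\<epsilon> \<longlonglongrightarrow> 0" "\<And>N. \<bar>(\<Sum>k<N. c k *\<^sub>R \<mu> k) - L\<bar> \<le> \<epsilon> N *\<^sub>R u"
    using assms(1) unfolding has_usum_def by blast
  have "\<bar>(\<Sum>k<N. (r * c k) *\<^sub>R \<mu> k) - r *\<^sub>R L\<bar> \<le> (\<bar>r\<bar> * \<epsilon> N) *\<^sub>R u" for N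
  proof -
    have eq: "(\<Sum>k<N. (r * c k) *\<^sub>R \<mu> k) - r *\<^sub>R L = r *\<^sub>R ((\<Sum>k<N. c k *\<^sub>R \<mu> k) - L)"
      by (simp add: scaleR_right_diff_distrib scaleR_sum_right)
    show ?thesis unfolding eq abs_scaleR
      using scaleR_left_mono[OF \<epsilon>(2), of "\<bar>r\<bar>"] by simp
  qed
  moreover have "(\<lambda>N. \<bar>r\<bar> * \<epsilon> N) \<longlonglongrightarrow> 0" using tendsto_mult_right_zero[OF \<epsilon>(1)] .
  ultimately show ?thesis unfolding has_usum_def by blast
qed

lemma has_usum_abs_le:
  assumes L: "has_usum c L" and c: "\<And>k. \<bar>c k\<bar> \<le> d k" and d: "summable d"
  shows "\<bar>L\<bar> \<le> suminf d *\<^sub>R u"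
proof -
  obtain \<epsilon> where \<epsilon>: "\<epsilon> \<longlonglongrightarrow> 0" "\<And>N. \<bar>(\<Sum>k<N. c k *\<^sub>R \<mu> k) - L\<bar> \<le> \<epsilon> N *\<^sub>R u"
    using L unfolding has_usum_def by blast
  have d0: "0 \<le> d k" for k using c[of k] by linarith
  have "\<bar>L\<bar> \<le> (suminf d + \<epsilon> N) *\<^sub>R u" for N
  proof -
    let ?S = "\<Sum>k<N. c k *\<^sub>R \<mu> k"
    have "\<bar>?S\<bar> \<le> (\<Sum>k<N. d k) *\<^sub>R u"
    proof (rule abs_leI)
      have "?S \<le> (\<Sum>k<N. d k *\<^sub>R u)"
        using c d0 by (intro sum_mono scaleR_le) (auto simp: abs_le_iff)
      then show "?S \<le> (\<Sum>k<N. d k) *\<^sub>R u" by (simp add: scaleR_sum_left)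
      have "(\<Sum>k<N. (- c k) *\<^sub>R \<mu> k) \<le> (\<Sum>k<N. d k *\<^sub>R u)"
        using c d0 by (intro sum_mono scaleR_le) (auto simp: abs_le_iff)
      then show "- ?S \<le> (\<Sum>k<N. d k) *\<^sub>R u" by (simp add: scaleR_sum_left sum_negf)
    qed
    also have "\<dots> \<le> suminf d *\<^sub>R u"
      using d d0 bound_nonneg by (intro scaleR_right_mono sum_le_suminf) auto
    finally have S: "\<bar>?S\<bar> \<le> suminf d *\<^sub>R u" .
    have "\<bar>L\<bar> = \<bar>?S - (?S - L)\<bar>" by simp
    also have "\<dots> \<le> \<bar>?S\<bar> + \<bar>?S - L\<bar>" by (rule abs_triangle_ineq4)
    also have "\<dots> \<le> suminf d *\<^sub>R u + \<epsilon> N *\<^sub>R u" using S \<epsilon>(2) by (rule add_mono)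
    finally show ?thesis by (simp only: scaleR_left_distrib)
  qed
  moreover have "(\<lambda>N. suminf d + \<epsilon> N) \<longlonglongrightarrow> suminf d + 0" using \<epsilon>(1) by (intro tendsto_intros)
  ultimately show ?thesis using le_scaleR_limit[of "\<bar>L\<bar>" "\<lambda>N. suminf d + \<epsilon> N" u "suminf d + 0"] bound_nonneg
    by simp
qed

text \<open>The \<open>n\<close>-th formal derivative of \<open>\<Sum>k. s ^ k *\<^sub>R \<mu> k\<close>. Truncated subtraction in the exponent does no harm,
  because the falling factorial vanishes for \<open>k < n\<close>.\<close>

definition power_series :: "nat \<Rightarrow> real \<Rightarrow> 'u" where
  "power_series n s = (SUP N. \<Sum>k<N. (falling (real k) n * s ^ (k - n)) *\<^sub>R \<mu> k)"

lemma
  assumes "0 \<le> s" "s < 1"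
  shows has_usum_power_series: "has_usum (\<lambda>k. falling (real k) n * s ^ (k - n)) (power_series n s)"
    and bdd_above_power_series: "bdd_above (range (\<lambda>N. \<Sum>k<N. (falling (real k) n * s ^ (k - n)) *\<^sub>R \<mu> k))"
proof -
  have "0 \<le> falling (real k) n * s ^ (k - n)" for k
    using assms falling_nonneg by (intro mult_nonneg_nonneg) auto
  from has_usum_Sup[OF this summable_falling[OF assms]]
  show "has_usum (\<lambda>k. falling (real k) n * s ^ (k - n)) (power_series n s)"
    and "bdd_above (range (\<lambda>N. \<Sum>k<N. (falling (real k) n * s ^ (k - n)) *\<^sub>R \<mu> k))"
    unfolding power_series_def by auto
qed

text \<open>Termwise differentiation. The error of the difference quotient is a series whose coefficients are
  bounded by \<open>\<bar>t - s\<bar>\<close> times a summable sequence, as long as \<open>s\<close> and \<open>t\<close> stay below some \<open>K < 1\<close>.\<close>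

lemma has_order_deriv_power_series:
  assumes s: "0 \<le> s" "s < 1"
  shows "has_order_deriv (power_series n) (power_series (Suc n) s) s {0..<1}"
proof -
  \<comment> \<open>\<open>K\<close> may be any number strictly between \<open>s\<close> and \<open>1\<close>.\<close>
  define K where "K = (1 + s) / 2"
  have K: "0 \<le> K" "s < K" "K < 1" using s by (auto simp: K_def)
  let ?d = "\<lambda>k. falling (real k) (n + 2) * K ^ (k - (n + 2))"
  define C where "C = suminf ?d"
  have d: "summable ?d" by (rule summable_falling[OF K(1,3)])
  have bound: "\<bar>(power_series n t - power_series n s) /\<^sub>R (t - s) - power_series (Suc n) s\<bar>
      \<le> (\<bar>t - s\<bar> * C) *\<^sub>R u" if t: "0 \<le> t" "t < K" "t \<noteq> s" for t
  proof -
    have "has_usum (\<lambda>k. inverse (t - s) * (falling (real k) n * t ^ (k - n) - falling (real k) n * s ^ (k - n))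
          - falling (real k) (Suc n) * s ^ (k - Suc n))
        ((power_series n t - power_series n s) /\<^sub>R (t - s) - power_series (Suc n) s)"
      using s t K by (intro has_usum_diff has_usum_scale has_usum_power_series) auto
    moreover have "\<bar>inverse (t - s) * (falling (real k) n * t ^ (k - n) - falling (real k) n * s ^ (k - n))
          - falling (real k) (Suc n) * s ^ (k - Suc n)\<bar> \<le> \<bar>t - s\<bar> * ?d k" for k
    proof -
      have "inverse (t - s) * (falling (real k) n * t ^ (k - n) - falling (real k) n * s ^ (k - n))
          = falling (real k) n * ((t ^ (k - n) - s ^ (k - n)) / (t - s))"
        by (simp add: divide_inverse right_diff_distrib mult_ac)
      then show ?thesis using falling_power_remainder[of s K t k n] s t K by simp
    qed
    ultimately have "\<bar>(power_series n t - power_series n s) /\<^sub>R (t - s) - power_series (Suc n) s\<bar>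
        \<le> suminf (\<lambda>k. \<bar>t - s\<bar> * ?d k) *\<^sub>R u"
      by (rule has_usum_abs_le) (intro summable_mult d)
    then show ?thesis unfolding C_def by (simp only: suminf_mult[OF d])
  qed
  have "eventually (\<lambda>t. t < K \<and> t \<noteq> s \<and> 0 \<le> t) (at s within {0..<1})"
    unfolding eventually_at_topological
    using K by (intro exI[of _ "{..<K}"]) auto
  then have "eventually (\<lambda>t. \<bar>(power_series n t - power_series n s) /\<^sub>R (t - s) - power_series (Suc n) s\<bar>
      \<le> (\<bar>t - s\<bar> * C) *\<^sub>R u) (at s within {0..<1})"
    by eventually_elim (use bound in blast)
  moreover have "((\<lambda>t. \<bar>t - s\<bar> * C) \<longlongrightarrow> \<bar>s - s\<bar> * C) (at s within {0..<1})"
    by (intro tendsto_intros)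
  ultimately show ?thesis
    unfolding has_order_deriv_def using bound_nonneg by (intro o_tendsto_uniform) auto
qed

text \<open>Order limits are unique, so the definite description in \<open>order_deriv\<close> returns the termwise
  derivative. The derivative at a point of \<open>[0,1)\<close> is taken within this interval and depends on the values there alone.\<close>

lemma iterated_order_deriv_eq:
  assumes f: "\<And>s. 0 \<le> s \<Longrightarrow> s < 1 \<Longrightarrow> f s = power_series 0 s" and s: "0 \<le> s" "s < 1"
  shows "(order_deriv {0..<1} ^^ n) f s = power_series n s"
  using s
proof (induction n arbitrary: s)
  case 0
  then show ?case using f by simp
next
  case (Suc n)
  let ?g = "(order_deriv {0..<1} ^^ n) f"
  have "eventually (\<lambda>t. (?g t - ?g s) /\<^sub>R (t - s) = (power_series n t - power_series n s) /\<^sub>R (t - s))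
      (at s within {0..<1})"
    using Suc by (auto simp: eventually_at_filter)
  then have iff: "has_order_deriv ?g D s {0..<1} \<longleftrightarrow> has_order_deriv (power_series n) D s {0..<1}" for D
    unfolding has_order_deriv_def by (rule o_tendsto_cong)
  have "at s within {0..<1} \<noteq> bot"
  proof -
    have "\<exists>t\<in>{0..<1}. t \<noteq> s \<and> dist t s < d" if "0 < d" for d
      using Suc.prems that
      by (intro bexI[of _ "s + min (d / 2) ((1 - s) / 2)"]) (auto simp: dist_real_def min_def field_simps)
    then show ?thesis unfolding trivial_limit_def eventually_at by force
  qed
  then have "order_deriv {0..<1} ?g s = power_series (Suc n) s"
    unfolding order_deriv_def iff
    using has_order_deriv_power_series[OF Suc.prems]
    by (intro the_equality) (auto simp: has_order_deriv_def dest: o_tendsto_unique)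
  then show ?case by simp
qed

text \<open>A version of Abel's argument for positive coefficients: the power series at \<open>s\<close> is at least \<open>s ^ N\<close>
  times the \<open>N\<close>-th partial sum at \<open>1\<close>, and \<open>s ^ N\<close> tends to \<open>1\<close>.\<close>

lemma partial_sum_le_if_power_series_le:
  assumes r: "0 \<le> r" "r < 1" and b: "\<And>s. r \<le> s \<Longrightarrow> s < 1 \<Longrightarrow> power_series n s \<le> b"
  shows "(\<Sum>k<N. falling (real k) n *\<^sub>R \<mu> k) \<le> b"
proof -
  let ?S = "\<Sum>k<N. falling (real k) n *\<^sub>R \<mu> k"
  \<comment> \<open>A sequence in \<open>[r, 1)\<close> that tends to \<open>1\<close>.\<close>
  define s where "s m = 1 - (1 - r) * inverse (real (Suc m))" for m
  have s: "r \<le> s m" "s m < 1" for m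
  proof -
    have "(1 - r) * inverse (real (Suc m)) \<le> (1 - r) * 1"
      using r by (intro mult_left_mono) (auto simp: field_simps)
    then show "r \<le> s m" by (simp add: s_def)
    show "s m < 1" using r by (simp add: s_def)
  qed
  have S: "0 \<le> ?S" using nonneg falling_nonneg by (intro sum_nonneg scaleR_nonneg_nonneg) auto
  have "?S - b \<le> (1 - s m ^ N) *\<^sub>R ?S" for m
  proof -
    have s0: "0 \<le> s m" using r s[of m] by simp
    have "s m ^ N *\<^sub>R ?S \<le> (\<Sum>k<N. (falling (real k) n * s m ^ (k - n)) *\<^sub>R \<mu> k)"
      unfolding scaleR_sum_right scaleR_scaleR
    proof (intro sum_mono scaleR_right_mono nonneg)
      fix k assume "k \<in> {..<N}"
      then have "s m ^ N \<le> s m ^ (k - n)" using s0 s[of m] by (intro power_decreasing) auto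
      then show "s m ^ N * falling (real k) n \<le> falling (real k) n * s m ^ (k - n)"
        using falling_nonneg[of k n] by (simp add: mult.commute mult_left_mono)
    qed
    also have "\<dots> \<le> power_series n (s m)"
      unfolding power_series_def using s0 s[of m] by (intro cSUP_upper bdd_above_power_series) auto
    also have "\<dots> \<le> b" using s by (rule b)
    finally have "s m ^ N *\<^sub>R ?S \<le> b" .
    then have "?S - b \<le> ?S - s m ^ N *\<^sub>R ?S" by (rule diff_left_mono)
    then show ?thesis by (simp only: scaleR_left_diff_distrib scaleR_one)
  qed
  moreover have "(\<lambda>m. 1 - s m ^ N) \<longlonglongrightarrow> 1 - (1 - (1 - r) * 0) ^ N"
    unfolding s_def by (intro tendsto_intros LIMSEQ_inverse_real_of_nat)
  ultimately have "?S - b \<le> (1 - (1 - (1 - r) * 0) ^ N) *\<^sub>R ?S"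
    using S by (rule le_scaleR_limit)
  then show ?thesis by simp
qed

lemma bdd_above_if_left_limit:
  assumes L: "o_tendsto f L (at_left 1)"
    and f: "\<And>s. 0 \<le> s \<Longrightarrow> s < 1 \<Longrightarrow> f s = power_series n s"
  shows "bdd_above (range (\<lambda>N. \<Sum>k<N. falling (real k) n *\<^sub>R \<mu> k))"
proof -
  obtain y where y: "eventually (\<lambda>s. \<bar>f s - L\<bar> \<le> y) (at_left 1)"
    using L unfolding o_tendsto_def by blast
  then obtain b where b: "b < 1" "\<And>s. b < s \<Longrightarrow> s < 1 \<Longrightarrow> \<bar>f s - L\<bar> \<le> y"
    unfolding eventually_at_left_field by blast
  define r where "r = max 0 ((b + 1) / 2)"
  have r: "0 \<le> r" "r < 1" "b < r" using b(1) by (auto simp: r_def less_max_iff_disj)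
  have "power_series n s \<le> L + y" if "r \<le> s" "s < 1" for s
  proof -
    have "f s - L \<le> y" using b(2)[of s] that r by (simp add: abs_le_iff)
    then have "f s \<le> L + y" by (simp only: diff_le_eq add.commute)
    then show ?thesis using f[of s] that r by simp
  qed
  then have "(\<Sum>k<N. falling (real k) n *\<^sub>R \<mu> k) \<le> L + y" for N
    using r by (intro partial_sum_le_if_power_series_le)
  then show ?thesis by (intro bdd_aboveI[of _ "L + y"]) auto
qed

text \<open>The power series increases with \<open>s\<close>, so its distances to the supremum of the partial sums at \<open>1\<close>
  form a decreasing net, and by \<open>partial_sum_le_if_power_series_le\<close> their infimum is \<open>0\<close>.\<close>

lemma left_limit_if_bdd_above:
  assumes bdd: "bdd_above (range (\<lambda>N. \<Sum>k<N. falling (real k) n *\<^sub>R \<mu> k))"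
    and f: "\<And>s. 0 \<le> s \<Longrightarrow> s < 1 \<Longrightarrow> f s = power_series n s"
  shows "o_tendsto f (SUP N. \<Sum>k<N. falling (real k) n *\<^sub>R \<mu> k) (at_left 1)"
proof -
  let ?L = "SUP N. \<Sum>k<N. falling (real k) n *\<^sub>R \<mu> k"
  have mono: "power_series n s \<le> power_series n t" if "0 \<le> s" "s \<le> t" "t < 1" for s t
    unfolding power_series_def
  proof (rule cSUP_mono)
    show "bdd_above (range (\<lambda>N. \<Sum>k<N. (falling (real k) n * t ^ (k - n)) *\<^sub>R \<mu> k))"
      using that by (intro bdd_above_power_series) auto
    show "\<exists>M\<in>UNIV. (\<Sum>k<N. (falling (real k) n * s ^ (k - n)) *\<^sub>R \<mu> k)
        \<le> (\<Sum>k<M. (falling (real k) n * t ^ (k - n)) *\<^sub>R \<mu> k)" for N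
      using that nonneg falling_nonneg
      by (intro bexI[of _ N] sum_mono scaleR_right_mono mult_left_mono power_mono) auto
  qed simp
  have le: "power_series n s \<le> ?L" if "0 \<le> s" "s < 1" for s
    unfolding power_series_def
  proof (rule cSUP_mono[OF _ bdd])
    have "falling (real k) n * s ^ (k - n) \<le> falling (real k) n" for k
      using that falling_nonneg[of k n] by (intro mult_left_le power_le_one) auto
    then show "\<exists>M\<in>UNIV. (\<Sum>k<N. (falling (real k) n * s ^ (k - n)) *\<^sub>R \<mu> k)
        \<le> (\<Sum>k<M. falling (real k) n *\<^sub>R \<mu> k)" for N
      using nonneg by (intro bexI[of _ N] sum_mono scaleR_right_mono) auto
  qed simp
  let ?Y = "(\<lambda>s. ?L - power_series n s) ` {0..<1}"
  show ?thesis
    unfolding o_tendsto_def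
  proof (intro exI[of _ ?Y] conjI ballI)
    show "?Y \<noteq> {}" by simp
    show "\<exists>c\<in>?Y. c \<le> a \<and> c \<le> b" if a: "a \<in> ?Y" and b: "b \<in> ?Y" for a b
    proof -
      obtain s where s: "s \<in> {0..<1}" "a = ?L - power_series n s" using a by blast
      obtain t where t: "t \<in> {0..<1}" "b = ?L - power_series n t" using b by blast
      have "power_series n s \<le> power_series n (max s t)" "power_series n t \<le> power_series n (max s t)"
        using s(1) t(1) by (intro mono; simp)+
      then have "?L - power_series n (max s t) \<le> a" "?L - power_series n (max s t) \<le> b"
        unfolding s(2) t(2) by (auto intro: diff_left_mono)
      moreover have "max s t \<in> {0..<1}" using s(1) t(1) by auto
      ultimately show ?thesis by blast
    qed
    show nn: "0 \<le> a" if "a \<in> ?Y" for a using that le by auto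
    then have bddY: "bdd_below ?Y" by (intro bdd_belowI[of _ 0])
    show "Inf ?Y = 0"
    proof (rule order.antisym)
      show "0 \<le> Inf ?Y" using nn by (intro cInf_greatest) auto
      have "power_series n s \<le> ?L - Inf ?Y" if "0 \<le> s" "s < 1" for s
      proof -
        have "Inf ?Y \<le> ?L - power_series n s" using that bddY by (intro cInf_lower) auto
        then show ?thesis by (simp only: le_diff_eq add.commute)
      qed
      then have "(\<Sum>k<N. falling (real k) n *\<^sub>R \<mu> k) \<le> ?L - Inf ?Y" for N
        by (intro partial_sum_le_if_power_series_le[of 0]) auto
      then have "?L \<le> ?L - Inf ?Y" by (intro cSUP_least) auto
      then show "Inf ?Y \<le> 0" by simp
    qed
    fix a assume "a \<in> ?Y"
    then obtain s where s: "s \<in> {0..<1}" "a = ?L - power_series n s" by blast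
    have "\<bar>f t - ?L\<bar> \<le> a" if t: "s < t" "t < 1" for t
    proof -
      have "power_series n t \<le> ?L" "power_series n s \<le> power_series n t"
        using s(1) t by (auto intro: le mono)
      then show ?thesis using f[of t] s t by (simp add: abs_of_nonpos)
    qed
    then show "eventually (\<lambda>t. \<bar>f t - ?L\<bar> \<le> a) (at_left 1)"
      unfolding eventually_at_left_field using s(1) by auto
  qed
qed

end

section \<open>The level components of a natural element\<close>

locale natural_element_triple = conditional_riesz_triple e T
  for e :: "'a::dedekind_complete_riesz_space" and T :: "'a \<Rightarrow> 'a" +
  fixes x :: 'a
  assumes natural: "natural_element e T x"
begin

definition level :: "nat \<Rightarrow> 'a" where
  "level k = eq_proj x (real k *\<^sub>R e) e"

lemma mass_eq: "mass e T x (real k) = T (level k)"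
  by (simp add: mass_def level_def)

lemma e_nonneg: "0 \<le> e"
  using unit by (simp add: weak_order_unit_def)

lemma level_nonneg: "0 \<le> level k" and level_le: "level k \<le> e"
  and level_component: "inf (level k) (e - level k) = 0"
  and level_disjoint_difference: "inf \<bar>x - real k *\<^sub>R e\<bar> (level k) = 0"
  using band_proj_decomposition[OF e_nonneg, of "\<bar>x - real k *\<^sub>R e\<bar>"]
  by (simp_all add: level_def eq_proj_def inf.commute)

text \<open>The sum of \<open>\<bar>x - j e\<bar>\<close> and \<open>\<bar>x - k e\<bar>\<close> dominates \<open>\<bar>j - k\<bar> e \<ge> e\<close>, but is disjoint from the meet
  of the two levels, which itself lies below \<open>e\<close>.\<close>

lemma level_disjoint:
  assumes jk: "j \<noteq> k"
  shows "inf (level j) (level k) = 0"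
proof -
  let ?w = "inf (level j) (level k)"
  have w: "0 \<le> ?w" using level_nonneg by simp
  have "inf \<bar>x - real j *\<^sub>R e\<bar> ?w = 0" "inf \<bar>x - real k *\<^sub>R e\<bar> ?w = 0"
    using disjoint_mono[OF _ w] level_disjoint_difference[of j] level_disjoint_difference[of k]
    by (metis inf.commute inf_le1, metis inf.commute inf_le2)
  then have *: "inf (\<bar>x - real j *\<^sub>R e\<bar> + \<bar>x - real k *\<^sub>R e\<bar>) ?w = 0" by (rule disjoint_add)
  have e_le: "e \<le> \<bar>real j - real k\<bar> *\<^sub>R e"
    using jk e_nonneg scaleR_right_mono[of 1 "\<bar>real j - real k\<bar>" e] by (cases "j < k") auto
  have "(real j - real k) *\<^sub>R e = (x - real k *\<^sub>R e) - (x - real j *\<^sub>R e)"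
    "(real k - real j) *\<^sub>R e = (x - real j *\<^sub>R e) - (x - real k *\<^sub>R e)"
    by (simp_all add: algebra_simps)
  then have "\<bar>real j - real k\<bar> *\<^sub>R e \<le> \<bar>x - real j *\<^sub>R e\<bar> + \<bar>x - real k *\<^sub>R e\<bar>"
    using abs_triangle_ineq4[of "x - real k *\<^sub>R e" "x - real j *\<^sub>R e"]
      abs_triangle_ineq4[of "x - real j *\<^sub>R e" "x - real k *\<^sub>R e"]
      abs_ge_self order_trans
    by (smt (verit) add.commute)
  moreover have "?w \<le> e" using level_le le_infI1 by blast
  ultimately have "?w \<le> \<bar>x - real j *\<^sub>R e\<bar> + \<bar>x - real k *\<^sub>R e\<bar>"
    using e_le by (meson order_trans)
  with * show ?thesis by (simp only: inf_absorb2)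
qed

lemma sum_level_le: "(\<Sum>k<N. level k) \<le> e"
  using level_disjoint level_nonneg level_le e_nonneg by (intro sum_disjoint_le) auto

text \<open>Here naturality enters. What the levels miss of \<open>e\<close> is a positive element whose image under \<open>T\<close> is
  below all remainders of the series of masses, so it is \<open>0\<close> by strict positivity.\<close>

lemma e_le_if_sum_level_le:
  assumes b: "\<And>N. (\<Sum>k<N. level k) \<le> b"
  shows "e \<le> b"
proof (rule ccontr)
  assume not_le: "\<not> e \<le> b"
  define q where "q = e - inf b e"
  have "0 \<le> q" unfolding q_def using inf_le2 by (rule diff_ge_0_iff_ge[THEN iffD2])
  moreover have "q \<noteq> 0"
  proof
    assume "q = 0"
    then have "e = inf b e" unfolding q_def by (rule right_minus_eq[THEN iffD1])
    then show False using not_le by (metis inf_le1)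
  qed
  ultimately have "0 < T q" using strictly_positive by (simp add: less_le)
  obtain Y where Y: "Y \<noteq> {}" "Inf Y = 0"
    "\<And>y. y \<in> Y \<Longrightarrow> eventually (\<lambda>N. \<bar>(\<Sum>k<N. mass e T x (real k)) - e\<bar> \<le> y) sequentially"
    using natural unfolding natural_element_def o_tendsto_def by blast
  have "T q \<le> y" if y: "y \<in> Y" for y
  proof -
    obtain N where N: "\<bar>(\<Sum>k<N. mass e T x (real k)) - e\<bar> \<le> y"
      using Y(3)[OF y] unfolding eventually_sequentially by blast
    have "q \<le> e - (\<Sum>k<N. level k)"
      unfolding q_def using b sum_level_le by (intro diff_left_mono) simp
    then have "T q \<le> T (e - (\<Sum>k<N. level k))" by (rule T_mono)
    also have "\<dots> = e - (\<Sum>k<N. mass e T x (real k))"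
      by (simp add: linear_diff[OF linear] linear_sum[OF linear] T_unit mass_eq)
    also have "\<dots> \<le> \<bar>(\<Sum>k<N. mass e T x (real k)) - e\<bar>"
      using abs_ge_minus_self[of "(\<Sum>k<N. mass e T x (real k)) - e"] by simp
    finally show ?thesis using N by (rule order_trans)
  qed
  then have "T q \<le> Inf Y" using Y(1) by (intro cInf_greatest)
  then show False using Y(2) \<open>0 < T q\<close> by simp
qed

end

section \<open>Spectral series and the generating function\<close>

locale natural_element_in_completion = natural_element_triple e T x + universal_completion \<iota>
  for e :: "'a::dedekind_complete_riesz_space" and T :: "'a \<Rightarrow> 'a" and x :: 'a
    and \<iota> :: "'a \<Rightarrow> 'u::universally_complete_f_algebra" +
  assumes \<iota>_unit: "\<iota> e = 1"
begin

lemmas T_linear = conditional_riesz_triple.linear[OF conditional_riesz_triple_axioms]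
lemmas \<iota>_linear = universal_completion.linear[OF universal_completion_axioms]

sublocale level: partition_of_unity "\<lambda>k. \<iota> (level k)"
proof
  show "inf (\<iota> (level k)) (1 - \<iota> (level k)) = 0" for k
    using level_component[of k]
    by (simp add: linear_diff[OF \<iota>_linear, symmetric] linear_0[OF \<iota>_linear] flip: \<iota>_unit inf)
  show "inf (\<iota> (level j)) (\<iota> (level k)) = 0" if "j \<noteq> k" for j k
    using level_disjoint[OF that] by (simp add: linear_0[OF \<iota>_linear] flip: inf)
  show "1 \<le> b" if b: "\<And>N. (\<Sum>k<N. \<iota> (level k)) \<le> b" for b
  proof -
    let ?D = "range (\<lambda>N. \<Sum>k<N. level k)"
    have bdd: "bdd_above ?D" using sum_level_le by (intro bdd_aboveI[of _ e]) auto
    have "e \<le> Sup ?D" by (rule e_le_if_sum_level_le) (intro cSup_upper bdd rangeI)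
    then have "\<iota> e \<le> \<iota> (Sup ?D)" by (simp only: le_iff)
    also have "\<dots> \<le> b"
    proof (rule Sup_le[OF _ bdd])
      fix d assume "d \<in> ?D"
      then show "\<iota> d \<le> b" using b by (auto simp: linear_sum[OF \<iota>_linear])
    qed simp
    finally show ?thesis by (simp add: \<iota>_unit)
  qed
qed

text \<open>The level at \<open>k\<close> is disjoint from \<open>x - k e\<close>, and disjoint elements have product \<open>0\<close>. Hence \<open>x\<close> acts
  on the level as multiplication by \<open>k\<close>.\<close>

lemma difference_mult_level:
  "\<iota> (x - real i *\<^sub>R e) * \<iota> (level k) = (real k - real i) *\<^sub>R \<iota> (level k)"
proof -
  have "inf \<bar>\<iota> (x - real k *\<^sub>R e)\<bar> (\<iota> (level k)) = \<iota> 0"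
    using level_disjoint_difference[of k] by (simp only: flip: abs inf)
  then have "\<iota> (x - real k *\<^sub>R e) * \<iota> (level k) = 0"
    by (intro f_algebra_abs_disjoint_mult_zero) (simp add: linear_0[OF \<iota>_linear])
  moreover have "x - real i *\<^sub>R e = (x - real k *\<^sub>R e) + (real k - real i) *\<^sub>R e"
    by (simp add: algebra_simps)
  then have "\<iota> (x - real i *\<^sub>R e) = \<iota> (x - real k *\<^sub>R e) + (real k - real i) *\<^sub>R 1"
    by (simp only: linear_add[OF \<iota>_linear] linear_scale[OF \<iota>_linear] \<iota>_unit)
  ultimately show ?thesis by (simp add: distrib_right)
qed

lemma power_mult_level: "\<iota> x ^ n * \<iota> (level k) = real k ^ n *\<^sub>R \<iota> (level k)"
proof (induction n)
  case (Suc n)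
  have "\<iota> x * \<iota> (level k) = real k *\<^sub>R \<iota> (level k)" using difference_mult_level[of 0 k] by simp
  then show ?case using Suc by (simp add: mult.assoc mult.commute)
qed simp

lemma falling_elem_mult_level:
  "falling_elem \<iota> e x n * \<iota> (level k) = falling (real k) n *\<^sub>R \<iota> (level k)"
proof (induction n)
  case 0
  then show ?case by (simp add: falling_elem_def falling_def)
next
  case (Suc n)
  have "falling_elem \<iota> e x (Suc n) = falling_elem \<iota> e x n * \<iota> (x - real n *\<^sub>R e)"
    by (simp add: falling_elem_def)
  then show ?case using Suc
    by (simp add: mult.assoc difference_mult_level falling_Suc mult.commute)
qed

text \<open>The expectation of a function of \<open>x\<close> that takes the value \<open>c k\<close> on level \<open>k\<close>. Positivity of \<open>a\<close> is
  not evident from its form: the falling product has factors that are not positive.\<close>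

lemma T_sup_spectral_series:
  assumes a: "\<And>k. a * \<iota> (level k) = c k *\<^sub>R \<iota> (level k)" and c: "\<And>k. 0 \<le> c k"
  shows "0 \<le> a"
    and "T_sup T (u_to_s \<iota> a) = (SUP N. sc_embed (\<Sum>k<N. c k *\<^sub>R mass e T x (real k)))"
proof -
  let ?y = "\<lambda>N. \<Sum>k<N. c k *\<^sub>R level k"
  have \<iota>y: "\<iota> (?y N) = (\<Sum>k<N. c k *\<^sub>R \<iota> (level k))" for N
    by (simp add: linear_sum[OF \<iota>_linear] linear_scale[OF \<iota>_linear])
  have Ty: "T (?y N) = (\<Sum>k<N. c k *\<^sub>R mass e T x (real k))" for N
    by (simp add: linear_sum[OF T_linear] linear_scale[OF T_linear] mass_eq)
  have y0: "0 \<le> ?y N" for N using c level_nonneg by (intro sum_nonneg scaleR_nonneg_nonneg) auto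
  have le: "\<iota> (?y N) \<le> a" for N unfolding \<iota>y using a c by (rule level.partial_sums_le)
  have least: "a \<le> b" if "\<And>N. \<iota> (?y N) \<le> b" for b
    using a that unfolding \<iota>y by (rule level.le_if_partial_sums_le)
  show a0: "0 \<le> a" using le[of 0] by (simp add: linear_0[OF \<iota>_linear])
  have bdd: "bdd_above (\<iota> ` range ?y)" using le by (intro bdd_aboveI[of _ a]) auto
  have "a = Sup (\<iota> ` range ?y)"
  proof (rule order.antisym)
    show "a \<le> Sup (\<iota> ` range ?y)" using bdd by (intro least cSup_upper) auto
    show "Sup (\<iota> ` range ?y) \<le> a" using le by (intro cSup_least) auto
  qed
  then have "u_to_s \<iota> a = Sup (sc_embed ` range ?y)"
    using u_to_s_Sup(2)[OF _ _ bdd] y0 by auto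
  moreover have "incseq ?y"
    using c level_nonneg by (intro incseq_SucI) (simp add: scaleR_nonneg_nonneg)
  ultimately have "T_sup T (u_to_s \<iota> a) = (SUP N. sc_embed (T (?y N)))"
    using T_sup_SUP[of ?y] y0 by (simp add: image_image)
  then show "T_sup T (u_to_s \<iota> a) = (SUP N. sc_embed (\<Sum>k<N. c k *\<^sub>R mass e T x (real k)))"
    by (simp only: Ty)
qed

sublocale mass: order_bounded_sequence "\<lambda>k. \<iota> (mass e T x (real k))" 1
proof
  show "0 \<le> \<iota> (mass e T x (real k))" for k
    using positive[OF level_nonneg] by (simp add: nonneg_iff mass_eq)
  show "\<iota> (mass e T x (real k)) \<le> 1" for k
    using T_mono[OF level_le[of k]] by (simp add: le_iff mass_eq T_unit flip: \<iota>_unit)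
qed

lemma mass_nonneg: "0 \<le> mass e T x (real k)"
  using positive[OF level_nonneg] by (simp add: mass_eq)

lemma \<iota>_sum_mass: "\<iota> (\<Sum>k<N. c k *\<^sub>R mass e T x (real k)) = (\<Sum>k<N. c k *\<^sub>R \<iota> (mass e T x (real k)))"
  by (simp add: linear_sum[OF \<iota>_linear] linear_scale[OF \<iota>_linear])

lemma mass_series_mem_iff:
  assumes "\<And>k. 0 \<le> c k"
  shows "(SUP N. sc_embed (\<Sum>k<N. c k *\<^sub>R mass e T x (real k))) \<in> u_to_s \<iota> ` {0..}
    \<longleftrightarrow> bdd_above (range (\<lambda>N. \<Sum>k<N. c k *\<^sub>R \<iota> (mass e T x (real k))))"
proof -
  let ?D = "range (\<lambda>N. \<Sum>k<N. c k *\<^sub>R mass e T x (real k))"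
  have "0 \<le> d" if "d \<in> ?D" for d
    using that assms mass_nonneg by (auto intro!: sum_nonneg scaleR_nonneg_nonneg)
  then have "Sup (sc_embed ` ?D) \<in> u_to_s \<iota> ` {0..} \<longleftrightarrow> bdd_above (\<iota> ` ?D)"
    by (intro Sup_mem_u_to_s_iff) auto
  then show ?thesis by (simp add: image_image \<iota>_sum_mass)
qed

lemma mass_series_eq:
  assumes c: "\<And>k. 0 \<le> c k"
    and bdd: "bdd_above (range (\<lambda>N. \<Sum>k<N. c k *\<^sub>R \<iota> (mass e T x (real k))))"
  shows "0 \<le> (SUP N. \<Sum>k<N. c k *\<^sub>R \<iota> (mass e T x (real k)))"
    and "u_to_s \<iota> (SUP N. \<Sum>k<N. c k *\<^sub>R \<iota> (mass e T x (real k)))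
      = (SUP N. sc_embed (\<Sum>k<N. c k *\<^sub>R mass e T x (real k)))"
proof -
  let ?D = "range (\<lambda>N. \<Sum>k<N. c k *\<^sub>R mass e T x (real k))"
  have nn: "0 \<le> d" if "d \<in> ?D" for d
    using that c mass_nonneg by (auto intro!: sum_nonneg scaleR_nonneg_nonneg)
  have img: "\<iota> ` ?D = range (\<lambda>N. \<Sum>k<N. c k *\<^sub>R \<iota> (mass e T x (real k)))"
    by (simp add: image_image \<iota>_sum_mass)
  have "bdd_above (\<iota> ` ?D)" using bdd unfolding img .
  from u_to_s_Sup[OF _ nn this, unfolded img, unfolded image_image]
  show "0 \<le> (SUP N. \<Sum>k<N. c k *\<^sub>R \<iota> (mass e T x (real k)))"
    and "u_to_s \<iota> (SUP N. \<Sum>k<N. c k *\<^sub>R \<iota> (mass e T x (real k)))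
      = (SUP N. sc_embed (\<Sum>k<N. c k *\<^sub>R mass e T x (real k)))"
    by blast+
qed

lemma gen_fun_u_eq:
  assumes s: "0 \<le> s" "s < 1"
  shows "gen_fun_u \<iota> e T x s = mass.power_series 0 s"
proof -
  have c: "0 \<le> falling (real k) 0 * s ^ (k - 0)" for k
    using s falling_nonneg by (intro mult_nonneg_nonneg) auto
  note ps = mass_series_eq[OF c mass.bdd_above_power_series[OF s], folded mass.power_series_def]
  have "gen_fun e T x s = u_to_s \<iota> (mass.power_series 0 s)"
    unfolding ps(2) gen_fun_def s_series_def
    by (simp add: sc_embed_sum falling_def atLeast0LessThan)
  then show ?thesis
    unfolding gen_fun_u_def using ps(1) inj_on_u_to_s by (simp add: inv_into_f_f)
qed

lemma gen_fun_deriv_eq: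
  "0 \<le> s \<Longrightarrow> s < 1 \<Longrightarrow> gen_fun_deriv \<iota> e T x n s = mass.power_series n s"
  unfolding gen_fun_deriv_def by (rule mass.iterated_order_deriv_eq) (rule gen_fun_u_eq)

text \<open>The terms with \<open>k < 2 n\<close> contribute a fixed finite sum; for all others \<open>power_le_falling\<close> applies.\<close>

lemma bdd_above_moments_iff:
  "bdd_above (range (\<lambda>N. \<Sum>k<N. real k ^ n *\<^sub>R \<iota> (mass e T x (real k))))
    \<longleftrightarrow> bdd_above (range (\<lambda>N. \<Sum>k<N. falling (real k) n *\<^sub>R \<iota> (mass e T x (real k))))"
  (is "bdd_above (range ?A) \<longleftrightarrow> bdd_above (range ?B)")
proof
  assume "bdd_above (range ?A)"
  then obtain M where M: "\<And>N. ?A N \<le> M" by (auto simp: bdd_above_def)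
  have "?B N \<le> ?A N" for N
    using mass.nonneg by (intro sum_mono scaleR_right_mono falling_le_power)
  then have "?B N \<le> M" for N using M order_trans by blast
  then show "bdd_above (range ?B)" by (intro bdd_aboveI[of _ M]) auto
next
  assume "bdd_above (range ?B)"
  then obtain M where M: "\<And>N. ?B N \<le> M" by (auto simp: bdd_above_def)
  have "?A N \<le> ?A (2 * n) + 2 ^ n *\<^sub>R ?B N" for N
  proof -
    let ?h = "\<lambda>k. if k < 2 * n then real k ^ n else 0"
    have "?A N \<le> (\<Sum>k<N. (?h k + 2 ^ n * falling (real k) n) *\<^sub>R \<iota> (mass e T x (real k)))"
      using mass.nonneg power_le_falling falling_nonneg
      by (intro sum_mono scaleR_right_mono) (auto simp: not_less)
    also have "\<dots> = (\<Sum>k<N. ?h k *\<^sub>R \<iota> (mass e T x (real k))) + 2 ^ n *\<^sub>R ?B N"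
      by (simp add: scaleR_left_distrib sum.distrib scaleR_sum_right)
    also have "(\<Sum>k<N. ?h k *\<^sub>R \<iota> (mass e T x (real k))) \<le> ?A (2 * n)"
    proof -
      have "(\<Sum>k<N. ?h k *\<^sub>R \<iota> (mass e T x (real k)))
          = (\<Sum>k\<in>{..<N} \<inter> {..<2 * n}. real k ^ n *\<^sub>R \<iota> (mass e T x (real k)))"
        by (intro sum.mono_neutral_cong_right) auto
      also have "\<dots> \<le> ?A (2 * n)"
        using mass.nonneg by (intro sum_mono2) (auto intro!: scaleR_nonneg_nonneg)
      finally show ?thesis .
    qed
    finally show ?thesis by simp
  qed
  moreover have "?A (2 * n) + 2 ^ n *\<^sub>R ?B N \<le> ?A (2 * n) + 2 ^ n *\<^sub>R M" for N
    using M by (intro add_left_mono scaleR_left_mono) auto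
  ultimately have "?A N \<le> ?A (2 * n) + 2 ^ n *\<^sub>R M" for N using order_trans by blast
  then show "bdd_above (range ?A)" by (intro bdd_aboveI[of _ "?A (2 * n) + 2 ^ n *\<^sub>R M"]) auto
qed

lemma s_series_falling:
  "s_series n (\<lambda>k. sc_embed (falling (real k) n *\<^sub>R mass e T x (real k)))
    = (SUP N. sc_embed (\<Sum>k<N. falling (real k) n *\<^sub>R mass e T x (real k)))"
proof -
  have "(\<Sum>k=n..<N. falling (real k) n *\<^sub>R mass e T x (real k))
      = (\<Sum>k<N. falling (real k) n *\<^sub>R mass e T x (real k))" for N
    by (intro sum.mono_neutral_left) (auto simp: falling_eq_0)
  then show ?thesis unfolding s_series_def by (simp flip: sc_embed_sum)
qed

end

section \<open>Factorial moments and left limits of derivatives\<close>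

theorem proposition21:
  fixes e x :: "'a::dedekind_complete_riesz_space"
    and T :: "'a \<Rightarrow> 'a"
    and \<iota> :: "'a \<Rightarrow> 'u::universally_complete_f_algebra"
    and n :: nat
  assumes "conditional_riesz_triple e T"
    and "universal_completion \<iota>"
    and "\<iota> e = 1"
    and "natural_element e T x"
  shows "(T_sup T (u_to_s \<iota> (\<iota> x ^ n)) \<in> u_to_s \<iota> ` {0..}
            \<longleftrightarrow> (\<exists>L. o_tendsto (gen_fun_deriv \<iota> e T x n) L (at_left 1)))
       \<and> (\<forall>L. o_tendsto (gen_fun_deriv \<iota> e T x n) L (at_left 1) \<longrightarrow>
              0 \<le> L \<and> 0 \<le> falling_elem \<iota> e x n
            \<and> u_to_s \<iota> L = T_sup T (u_to_s \<iota> (falling_elem \<iota> e x n))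
            \<and> u_to_s \<iota> L = s_series n (\<lambda>k. sc_embed (falling (real k) n *\<^sub>R mass e T x (real k))))"
proof -
  interpret conditional_riesz_triple e T by fact
  interpret universal_completion \<iota> by fact
  interpret natural_element_in_completion e T x \<iota>
    by unfold_locales fact+
  let ?B = "\<lambda>N. \<Sum>k<N. falling (real k) n *\<^sub>R \<iota> (mass e T x (real k))"
  have mem_iff: "T_sup T (u_to_s \<iota> (\<iota> x ^ n)) \<in> u_to_s \<iota> ` {0..} \<longleftrightarrow> bdd_above (range ?B)"
    using T_sup_spectral_series(2)[OF power_mult_level] mass_series_mem_iff bdd_above_moments_iff
    by simp
  have bdd_if: "bdd_above (range ?B)" if "o_tendsto (gen_fun_deriv \<iota> e T x n) L (at_left 1)" for L
    using that gen_fun_deriv_eq by (rule mass.bdd_above_if_left_limit)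
  have lim: "o_tendsto (gen_fun_deriv \<iota> e T x n) (SUP N. ?B N) (at_left 1)" if "bdd_above (range ?B)"
    using that gen_fun_deriv_eq by (rule mass.left_limit_if_bdd_above)
  have limit_value: "0 \<le> L \<and> 0 \<le> falling_elem \<iota> e x n
        \<and> u_to_s \<iota> L = T_sup T (u_to_s \<iota> (falling_elem \<iota> e x n))
        \<and> u_to_s \<iota> L = s_series n (\<lambda>k. sc_embed (falling (real k) n *\<^sub>R mass e T x (real k)))"
    if L: "o_tendsto (gen_fun_deriv \<iota> e T x n) L (at_left 1)" for L
  proof -
    have "L = (SUP N. ?B N)" using L lim[OF bdd_if[OF L]] by (rule o_tendsto_unique) simp
    then show ?thesis
      using mass_series_eq[OF falling_nonneg bdd_if[OF L]]
        T_sup_spectral_series[OF falling_elem_mult_level falling_nonneg]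
      by (simp only: s_series_falling simp_thms)
  qed
  moreover have "T_sup T (u_to_s \<iota> (\<iota> x ^ n)) \<in> u_to_s \<iota> ` {0..}
      \<longleftrightarrow> (\<exists>L. o_tendsto (gen_fun_deriv \<iota> e T x n) L (at_left 1))"
    unfolding mem_iff using lim bdd_if by (intro iffI exI) (assumption | erule exE)+
  ultimately show ?thesis using limit_value by (intro conjI[OF _ allI[OF impI]])
qed

end
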